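(* Let $m\ge 1$, let $D_1,D_2\in\mathcal{D}_+^m$, and let $Y$ be a random $m\times m$ real matrix whose distribution is absolutely continuous with respect to Lebesgue measure on $\mathbb{R}^{m\times m}$. Then, with probability one, the likelihood ratio statistic $T$ satisfies $T(D_1YD_2)=T(Y)$. Consequently the distribution of $T$ is the same under every element of the null hypothesis: if $Y\sim N_{m\times m}(0,\Sigma_{\mathrm r},\Sigma_{\mathrm c})$ with $(\Sigma_{\mathrm r},\Sigma_{\mathrm c})\in\mathcal{D}_+^m\times\mathcal{D}_+^m$ and $Y_0\sim N_{m\times m}(0,I,I)$, then $T(Y)$ and $T(Y_0)$ have the same distribution.
   Context: $\mathcal{D}_+^m$ is the set of $m\times m$ diagonal matrices with positive diagonal entries, and $\mathcal{S}_+^m$ the set of $m\times m$ real symmetric positive definite matrices. $Y\sim N_{m\times m}(0,\Sigma_{\mathrm r},\Sigma_{\mathrm c})$ means $\mathrm{vec}(Y)\sim N_{m^2}(0,\Sigma_{\mathrm c}\otimes\Sigma_{\mathrm r})$, with $\otimes$ the Kronecker product. The scaled log likelihood is $$l(\Sigma_{\mathrm r},\Sigma_{\mathrm c};Y)=\mathrm{tr}\left[\Sigma_{\mathrm r}^{-1}Y\Sigma_{\mathrm c}^{-1}Y^{t}\right]-\log\left|\Sigma_{\mathrm c}^{-1}\otimes\Sigma_{\mathrm r}^{-1}\right|,$$ where $|\cdot|$ is the determinant. The likelihood ratio statistic is $$T(Y)=l(\hat D_{\mathrm r},\hat D_{\mathrm c};Y)-l(\hat\Sigma_{\mathrm r},\hat\Sigma_{\mathrm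 c};Y),$$ where $(\hat D_{\mathrm r},\hat D_{\mathrm c})$ is any minimizer of $l(\cdot,\cdot;Y)$ over $\mathcal{D}_+^m\times\mathcal{D}_+^m$ and $(\hat\Sigma_{\mathrm r},\hat\Sigma_{\mathrm c})$ is any minimizer of $l(\cdot,\cdot;Y)$ over $\mathcal{S}_+^m\times\mathcal{S}_+^m$; both minimizers exist with probability one when $Y$ has an absolutely continuous distribution. *)

theory Defs
  imports "HOL-Probability.Probability"
begin

definition pos_diag :: "(real^'n^'n) set" where
  "pos_diag = {D. (\<forall>i. 0 < D $ i $ i) \<and> (\<forall>i j. i \<noteq> j \<longrightarrow> D $ i $ j = 0)}"

definition sym_pos_def :: "(real^'n^'n) set" where
  "sym_pos_def = {S. transpose S = S \<and> (\<forall>x. x \<noteq> 0 \<longrightarrow> 0 < x \<bullet> (S *v x))}"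

text \<open>The index pair \<open>(i, k)\<close> stands for position \<open>k\<close> inside block \<open>i\<close>.\<close>

definition kronecker :: "'a::times^'n^'m \<Rightarrow> 'a^'q^'p \<Rightarrow> 'a^('n \<times> 'q)^('m \<times> 'p)" where
  "kronecker A B = (\<chi> r c. A $ fst r $ fst c * B $ snd r $ snd c)"

text \<open>Column stacking: block \<open>j\<close> of the vectorization is column \<open>j\<close> of \<open>Y\<close>, in the same
  index convention as \<^const>\<open>kronecker\<close>. (The library constant \<^const>\<open>vec\<close> is the constant
  vector, not this operation.)\<close>

definition vectorize :: "'a^'n^'m \<Rightarrow> 'a^('n \<times> 'm)" where
  "vectorize Y = (\<chi> p. Y $ snd p $ fst p)"

text \<open>Density of the nondegenerate multivariate normal distribution (for \<open>S\<close> symmetric positive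
  definite).\<close>

definition mvn_density :: "real^'n \<Rightarrow> real^'n^'n \<Rightarrow> real^'n \<Rightarrow> real" where
  "mvn_density \<mu> S x =
     exp (- ((x - \<mu>) \<bullet> (matrix_inv S *v (x - \<mu>))) / 2) / sqrt ((2 * pi) ^ CARD('n) * det S)"

definition matrix_normal ::
    "'a measure \<Rightarrow> ('a \<Rightarrow> real^'n^'m) \<Rightarrow> real^'n^'m \<Rightarrow> real^'m^'m \<Rightarrow> real^'n^'n \<Rightarrow> bool" where
  "matrix_normal M Y A Sr Sc \<longleftrightarrow>
     distributed M lborel (\<lambda>\<omega>. vectorize (Y \<omega>))
       (\<lambda>x. ennreal (mvn_density (vectorize A) (kronecker Sc Sr) x))"

text \<open>The scaled log likelihood \<open>l\<close>; it is minimized, not maximized.\<close>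

definition scaled_loglik :: "real^'m^'m \<Rightarrow> real^'m^'m \<Rightarrow> real^'m^'m \<Rightarrow> real" where
  "scaled_loglik Sr Sc Y =
     trace (matrix_inv Sr ** Y ** matrix_inv Sc ** transpose Y)
     - ln (det (kronecker (matrix_inv Sc) (matrix_inv Sr)))"

definition is_minimizer ::
    "(real^'m^'m) set \<Rightarrow> real^'m^'m \<Rightarrow> (real^'m^'m) \<times> (real^'m^'m) \<Rightarrow> bool" where
  "is_minimizer P Y =
     is_arg_min (\<lambda>(Sr, Sc). scaled_loglik Sr Sc Y) (\<lambda>S. S \<in> P \<times> P)"

definition minimizers_exist :: "real^'m^'m \<Rightarrow> bool" where
  "minimizers_exist Y \<longleftrightarrow> (\<exists>D. is_minimizer pos_diag Y D) \<and> (\<exists>S. is_minimizer sym_pos_def Y S)"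

text \<open>All minimizers over a fixed set give the same value of the likelihood, so the description
  below is unique whenever both kinds of minimizer exist; otherwise the value is a fixed
  unspecified real number.\<close>

definition lr_stat :: "real^'m^'m \<Rightarrow> real" where
  "lr_stat Y = (THE t. \<exists>Dr Dc Sr Sc.
     is_minimizer pos_diag Y (Dr, Dc) \<and> is_minimizer sym_pos_def Y (Sr, Sc) \<and>
     t = scaled_loglik Dr Dc Y - scaled_loglik Sr Sc Y)"

end

theory Submission
  imports Defs
begin

text \<open>In terms of the precision matrices \<open>A = \<Sigma>\<^sub>r\<inverse>\<close>, \<open>B = \<Sigma>\<^sub>c\<inverse>\<close>, replacing \<open>Y\<close> by \<open>D\<^sub>1 Y D\<^sub>2\<close>
  amounts to replacing \<open>(A, B)\<close> by \<open>(D\<^sub>1 A D\<^sub>1, D\<^sub>2 B D\<^sub>2)\<close> and shifting the likelihood by a constant that depends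
  on \<open>D\<^sub>1, D\<^sub>2\<close> only. This congruence permutes the positive diagonal and the positive definite matrices, so both
  minima shift by the same constant and \<open>T\<close> is invariant, even for matrices without minimizers.

  The positive definite minimum exists as soon as \<open>det Y \<noteq> 0\<close>: diagonalizing \<open>A\<inverse>\<close> and \<open>Y B Y\<^sup>t\<close>
  simultaneously reduces the likelihood to a sum of terms \<open>d - m ln d\<close>. The diagonal one exists as soon as all
  entries of \<open>Y\<close> are nonzero, because the sublevel sets are compact up to the scaling \<open>(c A, B / c)\<close>.
  Both exceptional sets are null.\<close>

subsection \<open>Diagonal and positive definite matrices\<close>

definition diag_mat :: "'a::zero^'n \<Rightarrow> 'a^'n^'n" where
  "diag_mat d = (\<chi> i j. if i = j then d $ i else 0)"

lemma diag_mat_nth: "diag_mat d $ i $ j = (if i = j then d $ i else 0)"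
  by (simp add: diag_mat_def)

lemma transpose_diag_mat [simp]: "transpose (diag_mat d) = diag_mat d"
  by (auto simp: vec_eq_iff transpose_def diag_mat_nth)

lemma diag_mat_mul_nth: "(diag_mat a ** Y) $ i $ j = a $ i * (Y $ i $ j :: real)"
  by (simp add: matrix_matrix_mult_def diag_mat_nth mult_delta_left)

lemma mul_diag_mat_nth: "(Y ** diag_mat b) $ i $ j = Y $ i $ j * (b $ j :: real)"
  by (simp add: matrix_matrix_mult_def diag_mat_nth mult_delta_right)

lemma diag_mat_mult: "diag_mat a ** diag_mat b = diag_mat (\<chi> i. a $ i * (b $ i :: real))"
  by (simp add: vec_eq_iff diag_mat_mul_nth) (simp add: diag_mat_nth)

lemma mat_1_eq_diag_mat: "mat 1 = diag_mat (\<chi> i. 1)"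
  by (simp add: vec_eq_iff mat_def diag_mat_nth)

lemma diag_mat_mult_vec: "diag_mat a *v x = (\<chi> i. a $ i * (x $ i :: real))"
  by (simp add: vec_eq_iff matrix_vector_mult_def diag_mat_nth mult_delta_left)

lemma det_diag_mat: "det (diag_mat d) = (\<Prod>i\<in>UNIV. (d $ i :: real))"
  by (subst det_diagonal) (auto simp: diag_mat_nth)

lemma pos_diag_eq: "pos_diag = {diag_mat d | d. \<forall>i. 0 < d $ i}"
proof (intro equalityI subsetI)
  fix D :: "real^'n^'n" assume D: "D \<in> pos_diag"
  then have "D = diag_mat (\<chi> i. D $ i $ i)"
    by (simp add: vec_eq_iff diag_mat_nth pos_diag_def)
  moreover have "\<forall>i. 0 < (\<chi> i. D $ i $ i) $ i" using D by (simp add: pos_diag_def)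
  ultimately show "D \<in> {diag_mat d | d. \<forall>i. 0 < d $ i}" by blast
qed (auto simp: diag_mat_nth pos_diag_def)

lemma diag_mat_in_pos_diag [simp]: "diag_mat d \<in> pos_diag \<longleftrightarrow> (\<forall>i. 0 < d $ i)"
  by (auto simp: diag_mat_nth pos_diag_def)

lemma pos_diagE:
  assumes "D \<in> pos_diag"
  obtains d where "D = diag_mat d" "\<And>i. 0 < d $ i"
proof -
  obtain d where "D = diag_mat d" "\<forall>i. 0 < d $ i" using assms unfolding pos_diag_eq by blast
  then show thesis using that by blast
qed

lemma pos_diag_subset_sym_pos_def: "pos_diag \<subseteq> sym_pos_def"
proof
  fix D :: "real^'n^'n" assume "D \<in> pos_diag"
  then obtain d where D: "D = diag_mat d" and d: "\<And>i. 0 < d $ i" by (rule pos_diagE) blast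
  have "0 < x \<bullet> (D *v x)" if "x \<noteq> 0" for x
  proof -
    obtain i where "x $ i \<noteq> 0" using \<open>x \<noteq> 0\<close> by (auto simp: vec_eq_iff)
    then have "0 < d $ i * (x $ i)\<^sup>2" using d by simp
    moreover have "x \<bullet> (D *v x) = (\<Sum>i\<in>UNIV. d $ i * (x $ i)\<^sup>2)"
      by (simp add: D diag_mat_mult_vec inner_vec_def power2_eq_square mult_ac)
    ultimately show ?thesis
      using d by (auto intro!: sum_pos2[where i=i] simp: less_imp_le)
  qed
  then show "D \<in> sym_pos_def" by (simp add: sym_pos_def_def D)
qed

section \<open>Inverses and congruences of positive definite matrices\<close>

lemma matrix_inv_unique:
  fixes A B :: "real^'n^'n"
  assumes "A ** B = mat 1"
  shows "matrix_inv A = B"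
proof -
  have BA: "B ** A = mat 1" using assms by (simp add: matrix_left_right_inverse)
  have "A ** matrix_inv A = mat 1 \<and> matrix_inv A ** A = mat 1"
    unfolding matrix_inv_def by (rule someI[where x=B]) (use assms BA in simp)
  then have "B ** (A ** matrix_inv A) = B" by simp
  then show ?thesis by (simp add: matrix_mul_assoc BA)
qed

lemma matrix_inv_mult:
  fixes A :: "real^'n^'n"
  assumes "invertible A"
  shows "A ** matrix_inv A = mat 1" "matrix_inv A ** A = mat 1"
proof -
  obtain B where B: "A ** B = mat 1" "B ** A = mat 1" using assms unfolding invertible_def by blast
  then show "A ** matrix_inv A = mat 1" "matrix_inv A ** A = mat 1"
    using matrix_inv_unique[OF B(1)] by simp_all
qed

lemma matrix_inv_diag_mat:
  fixes d :: "real^'n"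
  assumes "\<And>i. d $ i \<noteq> 0"
  shows "matrix_inv (diag_mat d) = diag_mat (\<chi> i. 1 / d $ i)"
  by (rule matrix_inv_unique) (simp add: diag_mat_mult assms mat_1_eq_diag_mat)

lemma bilinear_sym:
  fixes S :: "real^'n^'n"
  assumes "transpose S = S"
  shows "x \<bullet> (S *v y) = y \<bullet> (S *v x)"
  by (metis assms dot_lmul_matrix inner_commute transpose_matrix_vector)

lemma spd_invertible:
  assumes "S \<in> sym_pos_def"
  shows "invertible S"
proof -
  have "\<forall>x. S *v x = 0 \<longrightarrow> x = 0"
    using assms by (force simp: sym_pos_def_def)
  then show ?thesis
    by (metis invertible_left_inverse matrix_left_invertible_ker)
qed

lemma spd_matrix_inv:
  assumes S: "S \<in> sym_pos_def"
  shows "matrix_inv S \<in> sym_pos_def"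
proof -
  note inv = matrix_inv_mult[OF spd_invertible[OF S]]
  have tS: "transpose S = S" using S by (simp add: sym_pos_def_def)
  have "S ** transpose (matrix_inv S) = mat 1"
    by (metis inv(2) matrix_transpose_mul tS transpose_mat)
  then have sym: "transpose (matrix_inv S) = matrix_inv S"
    using matrix_inv_unique by metis
  have "0 < x \<bullet> (matrix_inv S *v x)" if "x \<noteq> 0" for x
  proof -
    define y where "y = matrix_inv S *v x"
    have x: "x = S *v y" by (simp add: y_def matrix_vector_mul_assoc inv)
    then have "y \<noteq> 0" using that by auto
    then have "0 < y \<bullet> (S *v y)" using S by (simp add: sym_pos_def_def)
    then show ?thesis by (simp add: x[symmetric] y_def[symmetric] inner_commute)
  qed
  with sym show ?thesis by (simp add: sym_pos_def_def)
qed

lemma pos_diag_matrix_inv: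
  assumes "D \<in> pos_diag"
  shows "matrix_inv D \<in> pos_diag"
  using assms by (auto elim!: pos_diagE simp: matrix_inv_diag_mat less_imp_neq[symmetric])

lemma matrix_inv_matrix_inv:
  fixes A :: "real^'n^'n"
  assumes "invertible A"
  shows "matrix_inv (matrix_inv A) = A"
  by (rule matrix_inv_unique) (rule matrix_inv_mult(2)[OF assms])

lemma quadratic_form_congruence:
  fixes S :: "real^'n^'n" and V :: "real^'n^'m"
  shows "x \<bullet> ((V ** S ** transpose V) *v y) = (transpose V *v x) \<bullet> (S *v (transpose V *v y))"
  by (simp add: matrix_vector_mul_assoc[symmetric] dot_lmul_matrix)

lemma transpose_congruence:
  fixes S :: "real^'n^'n" and V :: "real^'n^'m"
  assumes "transpose S = S"
  shows "transpose (V ** S ** transpose V) = V ** S ** transpose V"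
  using assms by (simp add: matrix_transpose_mul matrix_mul_assoc)

lemma spd_congruence:
  fixes S V :: "real^'n^'n"
  assumes S: "S \<in> sym_pos_def" and V: "invertible V"
  shows "V ** S ** transpose V \<in> sym_pos_def"
proof -
  have "transpose V *v x \<noteq> 0" if "x \<noteq> 0" for x
    using that transpose_invertible[OF V]
    by (metis invertible_left_inverse matrix_left_invertible_ker)
  then have "0 < x \<bullet> ((V ** S ** transpose V) *v x)" if "x \<noteq> 0" for x
    using that S unfolding quadratic_form_congruence by (simp add: sym_pos_def_def)
  moreover have "transpose (V ** S ** transpose V) = V ** S ** transpose V"
    using S by (intro transpose_congruence) (simp add: sym_pos_def_def)
  ultimately show ?thesis unfolding sym_pos_def_def by blast
qed

section \<open>Simultaneous diagonalization of two quadratic forms\<close>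

lemma spd_coercive:
  fixes S :: "real^'n^'n"
  assumes "S \<in> sym_pos_def"
  obtains c where "0 < c" "\<And>x. c * (norm x)\<^sup>2 \<le> x \<bullet> (S *v x)"
proof -
  have ne: "sphere (0::real^'n) 1 \<noteq> {}" by (simp add: sphere_eq_empty)
  have "continuous_on (sphere 0 1) (\<lambda>x. x \<bullet> (S *v x))"
    by (intro continuous_intros)
  \<comment> \<open>The coercivity constant is the least value of the form on the unit sphere;
    homogeneity of degree two extends the bound to all vectors.\<close>
  then obtain u where u: "norm u = 1" "\<And>x. norm x = 1 \<Longrightarrow> u \<bullet> (S *v u) \<le> x \<bullet> (S *v x)"
    using continuous_attains_inf[OF compact_sphere ne] by force
  show ?thesis
  proof
    have "u \<noteq> 0" using u(1) by auto
    then show "0 < u \<bullet> (S *v u)" using assms by (simp add: sym_pos_def_def)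
    fix x show "(u \<bullet> (S *v u)) * (norm x)\<^sup>2 \<le> x \<bullet> (S *v x)"
    proof (cases "x = 0")
      case False
      define y where "y = (1 / norm x) *\<^sub>R x"
      have x: "x = norm x *\<^sub>R y" and y: "norm y = 1" using False by (simp_all add: y_def)
      have "x \<bullet> (S *v x) = (norm x)\<^sup>2 * (y \<bullet> (S *v y))"
        by (subst (1 2) x) (simp add: matrix_vector_mult_scaleR power2_eq_square)
      then show ?thesis using u(2)[OF y] by (simp add: mult.commute mult_right_mono)
    qed simp
  qed
qed

text \<open>As \<open>t\<close> tends to 0 a linear term dominates a quadratic one. This serves as
  the first-order condition at a maximum without differentiating.\<close>

lemma linear_term_zero_if_quadratic_bound:
  fixes b K :: real
  assumes "\<And>t. 2 * t * b \<le> t\<^sup>2 * K"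
  shows "b = 0"
proof (rule ccontr)
  assume "b \<noteq> 0"
  \<comment> \<open>\<open>L\<close> is positive and at least \<open>K\<close>, so
    \<open>t = b / L\<close> turns the bound into 2 b^2 / L \<le> b^2 / L, which fails for
    \<open>b \<noteq> 0\<close>.\<close>
  define L where "L = \<bar>K\<bar> + 1"
  have "2 * (b / L) * b \<le> (b / L)\<^sup>2 * K" by (rule assms)
  also have "\<dots> \<le> (b / L)\<^sup>2 * L" by (intro mult_left_mono) (auto simp: L_def)
  also have "\<dots> = (b / L) * b" by (simp add: power2_eq_square L_def)
  finally have "b * b / L \<le> 0" by simp
  moreover have "0 < b * b" using \<open>b \<noteq> 0\<close> by (metis power2_eq_square zero_less_power2)
  then have "0 < b * b / L" by (simp add: L_def)
  ultimately show False by linarith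
qed

text \<open>The vector maximizes the form of \<open>C\<close> on the compact set of
  \<open>S\<close>-unit vectors of \<open>U\<close>. The last conclusion is the Lagrange condition:
  relative to \<open>U\<close>, \<open>x\<close> is a generalized eigenvector of the pair.\<close>

lemma rayleigh_maximizer:
  fixes S C :: "real^'n^'n"
  assumes S: "S \<in> sym_pos_def" and C: "transpose C = C"
    and U: "subspace U" "U \<noteq> {0}"
  obtains x where "x \<in> U" "x \<bullet> (S *v x) = 1"
    "\<And>y. y \<in> U \<Longrightarrow> y \<bullet> (S *v x) = 0 \<Longrightarrow> y \<bullet> (C *v x) = 0"
proof -
  have tS: "transpose S = S" using S by (simp add: sym_pos_def_def)
  define K where "K = {x \<in> U. x \<bullet> (S *v x) = 1}"
  have normalize: "(1 / sqrt (z \<bullet> (S *v z))) *\<^sub>R z \<in> K" if "z \<in> U" "z \<noteq> 0" for z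
  proof -
    have "0 < z \<bullet> (S *v z)" using that S by (simp add: sym_pos_def_def)
    then show ?thesis
      using that U(1) by (simp add: K_def matrix_vector_mult_scaleR subspace_scale)
  qed
  obtain z0 where "z0 \<in> U" "z0 \<noteq> 0" using U subspace_0[OF U(1)] by blast
  then have ne: "K \<noteq> {}" using normalize by blast
  obtain c where c: "0 < c" "\<And>x. c * (norm x)\<^sup>2 \<le> x \<bullet> (S *v x)" using spd_coercive[OF S] by metis
  have "bounded K"
    unfolding bounded_iff
  proof (intro exI ballI)
    fix x assume "x \<in> K"
    then have "c * (norm x)\<^sup>2 \<le> 1" using c(2)[of x] by (simp add: K_def)
    then have "(norm x)\<^sup>2 \<le> 1 / c" using c(1) by (simp add: pos_le_divide_eq mult.commute)
    then show "norm x \<le> sqrt (1 / c)" by (rule real_le_rsqrt)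
  qed
  moreover have "closed K"
  proof -
    have "closed {x. x \<bullet> (S *v x) = 1}"
      by (intro closed_Collect_eq continuous_intros)
    then have "closed (U \<inter> {x. x \<bullet> (S *v x) = 1})" using closed_subspace[OF U(1)] by (rule closed_Int[rotated])
    moreover have "K = U \<inter> {x. x \<bullet> (S *v x) = 1}" by (auto simp: K_def)
    ultimately show ?thesis by simp
  qed
  ultimately have "compact K" by (simp add: compact_eq_bounded_closed)
  moreover have "continuous_on K (\<lambda>x. x \<bullet> (C *v x))" by (intro continuous_intros)
  ultimately obtain x where x: "x \<in> K" and max: "\<And>y. y \<in> K \<Longrightarrow> y \<bullet> (C *v y) \<le> x \<bullet> (C *v x)"
    using continuous_attains_sup[OF _ ne] by metis
  have xU: "x \<in> U" "x \<bullet> (S *v x) = 1" using x by (auto simp: K_def)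
  show ?thesis
  proof
    show "x \<in> U" "x \<bullet> (S *v x) = 1" by (fact xU)+
    fix y assume y: "y \<in> U" "y \<bullet> (S *v x) = 0"
    \<comment> \<open>Perturb the maximizer to \<open>x + t y\<close>. Since \<open>y\<close> is
      \<open>S\<close>-orthogonal to \<open>x\<close>, the \<open>S\<close>-form of the perturbed
      vector changes only at order t^2, so comparing it, after normalization, with the maximum
      leaves a linear term bounded by a quadratic one.\<close>
    have "2 * t * (y \<bullet> (C *v x)) \<le> t\<^sup>2 * ((y \<bullet> (S *v y)) * (x \<bullet> (C *v x)) - y \<bullet> (C *v y))" for t
    proof -
      define z where "z = x + t *\<^sub>R y"
      have zU: "z \<in> U" using xU y U(1) by (simp add: z_def subspace_add subspace_scale)
      have Sz: "z \<bullet> (S *v z) = 1 + t\<^sup>2 * (y \<bullet> (S *v y))"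
        using xU y bilinear_sym[OF tS, of x y]
        by (simp add: z_def matrix_vector_right_distrib matrix_vector_mult_scaleR inner_add_left inner_add_right power2_eq_square)
      have "0 \<le> y \<bullet> (S *v y)" using c(1) c(2)[of y] by (smt (verit) mult_nonneg_nonneg zero_le_power2)
      then have pos: "0 < z \<bullet> (S *v z)" unfolding Sz by (smt (verit) mult_nonneg_nonneg zero_le_power2)
      then have "z \<noteq> 0" by auto
      define q where "q = z \<bullet> (S *v z)"
      have q: "0 < q" using pos by (simp add: q_def)
      have "1 / sqrt q * (1 / sqrt q * (z \<bullet> (C *v z))) \<le> x \<bullet> (C *v x)"
        using max[OF normalize[OF zU \<open>z \<noteq> 0\<close>]]
        by (simp only: q_def[symmetric] matrix_vector_mult_scaleR inner_scaleR_left inner_scaleR_right)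
      moreover have "1 / sqrt q * (1 / sqrt q * (z \<bullet> (C *v z))) = z \<bullet> (C *v z) / q"
        using q by (simp add: divide_simps)
      ultimately have "z \<bullet> (C *v z) \<le> (x \<bullet> (C *v x)) * q" using q by (simp add: pos_divide_le_eq)
      moreover have "z \<bullet> (C *v z) = x \<bullet> (C *v x) + 2 * t * (y \<bullet> (C *v x)) + t\<^sup>2 * (y \<bullet> (C *v y))"
        using bilinear_sym[OF C, of x y]
        by (simp add: z_def matrix_vector_right_distrib matrix_vector_mult_scaleR inner_add_left inner_add_right power2_eq_square distrib_left)
      ultimately show ?thesis unfolding q_def Sz by (simp add: algebra_simps)
    qed
    then show "y \<bullet> (C *v x) = 0" by (rule linear_term_zero_if_quadratic_bound)
  qed
qed

text \<open>The rows of \<open>V\<close> form an \<open>S\<close>-orthonormal,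
  \<open>C\<close>-orthogonal family built by induction: each new row maximizes the form of
  \<open>C\<close> among the \<open>S\<close>-unit vectors that are \<open>S\<close>-orthogonal to
  the earlier rows.\<close>

lemma simultaneous_diagonalization:
  fixes S C :: "real^'n^'n"
  assumes S: "S \<in> sym_pos_def" and C: "transpose C = C"
  obtains V :: "real^'n^'n" and d where "V ** S ** transpose V = mat 1" "V ** C ** transpose V = diag_mat d"
proof -
  have tS: "transpose S = S" using S by (simp add: sym_pos_def_def)
  \<comment> \<open>The third conjunct strengthens the induction: every vector
    \<open>S\<close>-orthogonal to the family is also \<open>C\<close>-orthogonal to it, so the next
    maximizer is automatically \<open>C\<close>-orthogonal to the earlier vectors.\<close>
  have "\<exists>v::'n \<Rightarrow> real^'n. (\<forall>i\<in>I. \<forall>j\<in>I. v i \<bullet> (S *v v j) = (if i = j then 1 else 0)) \<and>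
      (\<forall>i\<in>I. \<forall>j\<in>I. i \<noteq> j \<longrightarrow> v i \<bullet> (C *v v j) = 0) \<and>
      (\<forall>y. (\<forall>j\<in>I. y \<bullet> (S *v v j) = 0) \<longrightarrow> (\<forall>i\<in>I. y \<bullet> (C *v v i) = 0))"
    for I :: "'n set"
  proof (induction I rule: finite_induct[OF finite])
    case 1
    then show ?case by simp
  next
    case (2 k I)
    from 2(3) obtain v :: "'n \<Rightarrow> real^'n" where
      v: "\<forall>i\<in>I. \<forall>j\<in>I. v i \<bullet> (S *v v j) = (if i = j then 1 else 0)"
        "\<forall>i\<in>I. \<forall>j\<in>I. i \<noteq> j \<longrightarrow> v i \<bullet> (C *v v j) = 0"
        "\<forall>y. (\<forall>j\<in>I. y \<bullet> (S *v v j) = 0) \<longrightarrow> (\<forall>i\<in>I. y \<bullet> (C *v v i) = 0)"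
      by (elim exE conjE)
    have v1: "v i \<bullet> (S *v v j) = (if i = j then 1 else 0)" if "i \<in> I" "j \<in> I" for i j
      using v(1) that by blast
    have v2: "v i \<bullet> (C *v v j) = 0" if "i \<in> I" "j \<in> I" "i \<noteq> j" for i j
      using v(2) that by blast
    have v3: "y \<bullet> (C *v v i) = 0" if "\<And>j. j\<in>I \<Longrightarrow> y \<bullet> (S *v v j) = 0" "i \<in> I" for y i
      using v(3) that by blast
    define U where "U = {x. \<forall>j\<in>I. x \<bullet> (S *v v j) = 0}"
    have subU: "subspace U" by (simp add: U_def subspace_def inner_add_left)
    \<comment> \<open>Fewer than n linear conditions define \<open>U\<close>, so it contains a
      nonzero vector.\<close>
    have "card I < CARD('n)" using 2(2) by (intro psubset_card_mono) auto
    moreover have "dim ((\<lambda>j. S *v v j) ` I) \<le> card ((\<lambda>j. S *v v j) ` I)" by (rule dim_le_card') simp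
    moreover have "card ((\<lambda>j. S *v v j) ` I) \<le> card I" by (rule card_image_le) simp
    ultimately have "dim ((\<lambda>j. S *v v j) ` I) < DIM(real^'n)" by simp
    then obtain w where "w \<noteq> 0" "\<And>y. y \<in> span ((\<lambda>j. S *v v j) ` I) \<Longrightarrow> orthogonal w y"
      using orthogonal_to_subspace_exists by metis
    then have "w \<in> U" "w \<noteq> 0" by (auto simp: U_def orthogonal_def span_base)
    then have neU: "U \<noteq> {0}" by auto
    obtain x where x: "x \<in> U" "x \<bullet> (S *v x) = 1"
      "\<And>y. y \<in> U \<Longrightarrow> y \<bullet> (S *v x) = 0 \<Longrightarrow> y \<bullet> (C *v x) = 0"
      using rayleigh_maximizer[OF S C subU neU] by metis
    have xS: "x \<bullet> (S *v v j) = 0" "v j \<bullet> (S *v x) = 0" if "j \<in> I" for j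
      using x(1) that bilinear_sym[OF tS, of x "v j"] by (auto simp: U_def)
    have xC: "x \<bullet> (C *v v j) = 0" "v j \<bullet> (C *v x) = 0" if "j \<in> I" for j
      using v3[OF xS(1) that] bilinear_sym[OF C, of x "v j"] by auto
    have [simp]: "k \<noteq> i" "i \<noteq> k" if "i \<in> I" for i using 2(2) that by auto
    show ?case
    proof (intro exI[where x="v(k := x)"] conjI)
      show "\<forall>i\<in>insert k I. \<forall>j\<in>insert k I. (v(k:=x)) i \<bullet> (S *v (v(k:=x)) j) = (if i = j then 1 else 0)"
        using x(2) xS v1 by simp
      show "\<forall>i\<in>insert k I. \<forall>j\<in>insert k I. i \<noteq> j \<longrightarrow> (v(k:=x)) i \<bullet> (C *v (v(k:=x)) j) = 0"
        using xC v2 by simp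
      show "\<forall>y. (\<forall>j\<in>insert k I. y \<bullet> (S *v (v(k:=x)) j) = 0) \<longrightarrow> (\<forall>i\<in>insert k I. y \<bullet> (C *v (v(k:=x)) i) = 0)"
        using x(3) v3 by (simp add: U_def)
    qed
  qed
  from this[of UNIV] obtain v :: "'n \<Rightarrow> real^'n" where
    v0: "\<forall>i\<in>UNIV. \<forall>j\<in>UNIV. v i \<bullet> (S *v v j) = (if i = j then 1 else 0)"
      "\<forall>i\<in>UNIV. \<forall>j\<in>UNIV. i \<noteq> j \<longrightarrow> v i \<bullet> (C *v v j) = 0"
    by (elim exE conjE)
  have v: "v i \<bullet> (S *v v j) = (if i = j then 1 else 0)" "i \<noteq> j \<Longrightarrow> v i \<bullet> (C *v v j) = 0" for i j
    using v0 by simp_all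
  define V where "V = (\<chi> i. v i)"
  have entry: "(V ** A ** transpose V) $ i $ j = v i \<bullet> (A *v v j)" for A i j
    by (simp add: V_def matrix_matrix_mult_def transpose_def matrix_vector_mult_def inner_vec_def
        sum_distrib_left sum_distrib_right mult.assoc) (rule sum.swap)
  show ?thesis
  proof
    show "V ** S ** transpose V = mat 1" by (simp add: vec_eq_iff entry v mat_def)
    show "V ** C ** transpose V = diag_mat (\<chi> i. v i \<bullet> (C *v v i))"
      by (simp add: vec_eq_iff entry v diag_mat_nth)
  qed
qed

subsection \<open>Kronecker products\<close>

lemma kronecker_nth [simp]: "kronecker A B $ r $ c = A $ fst r $ fst c * B $ snd r $ snd c"
  by (simp add: kronecker_def)

text \<open>The mixed-product rule: a sum over index pairs factors into a product of two
  sums.\<close>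

lemma kronecker_mult:
  fixes A B :: "real^'m^'m" and C D :: "real^'n^'n"
  shows "kronecker (A ** B) (C ** D) = kronecker A C ** kronecker B D"
proof -
  have "(\<Sum>k\<in>UNIV. A $ fst r $ k * B $ k $ fst c) * (\<Sum>l\<in>UNIV. C $ snd r $ l * D $ l $ snd c) =
    (\<Sum>p\<in>UNIV. A $ fst r $ fst p * C $ snd r $ snd p * (B $ fst p $ fst c * D $ snd p $ snd c))" for r c
    unfolding sum_product UNIV_Times_UNIV[symmetric] sum.cartesian_product
    by (intro sum.cong) (auto simp: mult_ac)
  then show ?thesis by (simp add: vec_eq_iff matrix_matrix_mult_def)
qed

lemma transpose_kronecker: "transpose (kronecker A B) = kronecker (transpose A) (transpose B)"
  by (simp add: vec_eq_iff transpose_def)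

lemma kronecker_diag_mat:
  "kronecker (diag_mat a) (diag_mat b) = diag_mat (\<chi> p. a $ fst p * (b $ snd p :: real))"
  by (auto simp: vec_eq_iff diag_mat_nth prod_eq_iff)

lemma kronecker_mat_1: "kronecker (mat 1) (mat 1) = (mat 1 :: real^('m::finite \<times> 'n::finite)^('m \<times> 'n))"
  by (auto simp: vec_eq_iff mat_def prod_eq_iff)

lemma det_kronecker_diag_mat:
  "det (kronecker (diag_mat a) (diag_mat b :: real^'n^'n)) =
    det (diag_mat a :: real^'m^'m) ^ CARD('n) * det (diag_mat b) ^ CARD('m)"
proof -
  have "(\<Prod>p\<in>UNIV. a $ fst p * b $ snd p) = (\<Prod>i\<in>UNIV. \<Prod>j\<in>UNIV. a $ i * b $ j)"
    unfolding UNIV_Times_UNIV[symmetric] prod.cartesian_product by (simp add: case_prod_beta)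
  also have "\<dots> = (\<Prod>i\<in>UNIV. a $ i) ^ CARD('n) * (\<Prod>j\<in>UNIV. b $ j) ^ CARD('m)"
    by (simp add: prod.distrib prod_power_distrib)
  finally show ?thesis by (simp add: kronecker_diag_mat det_diag_mat)
qed

lemma sym_pos_def_mat_1 [simp]: "mat 1 \<in> sym_pos_def"
  by (simp add: sym_pos_def_def)

text \<open>Diagonalization relative to the identity makes \<open>V\<close> and \<open>W\<close>
  orthogonal. Their Kronecker product is then orthogonal too, and congruence by an orthogonal matrix
  keeps the determinant, which leaves the diagonal case.\<close>

lemma det_kronecker_symmetric:
  fixes A :: "real^'m^'m" and B :: "real^'n^'n"
  assumes "transpose A = A" "transpose B = B"
  shows "det (kronecker A B) = det A ^ CARD('n) * det B ^ CARD('m)"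
proof -
  obtain V :: "real^'m^'m" and a where
    V0: "V ** mat 1 ** transpose V = mat 1" and V1: "V ** A ** transpose V = diag_mat a"
    by (rule simultaneous_diagonalization[OF sym_pos_def_mat_1 assms(1)])
  note V = V0[unfolded matrix_mul_rid] V1
  obtain W :: "real^'n^'n" and b where
    W0: "W ** mat 1 ** transpose W = mat 1" and W1: "W ** B ** transpose W = diag_mat b"
    by (rule simultaneous_diagonalization[OF sym_pos_def_mat_1 assms(2)])
  note W = W0[unfolded matrix_mul_rid] W1
  have sq: "det X * det X = 1" if "X ** transpose X = mat 1" for X :: "real^'k^'k"
    using det_mul[of X "transpose X"] by (simp add: that)
  have cong: "det (X ** M ** transpose X) = det M" if "X ** transpose X = mat 1" for X M :: "real^'k^'k"
    using sq[OF that] by (simp add: det_mul mult_ac)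
  have K: "kronecker V W ** transpose (kronecker V W) = mat 1"
    by (simp add: transpose_kronecker kronecker_mult[symmetric] V W kronecker_mat_1)
  have "det (kronecker A B) = det (kronecker V W ** kronecker A B ** transpose (kronecker V W))"
    by (simp add: cong[OF K])
  also have "\<dots> = det (kronecker (diag_mat a) (diag_mat b))"
    by (simp add: transpose_kronecker kronecker_mult[symmetric] V W)
  also have "\<dots> = det (V ** A ** transpose V) ^ CARD('n) * det (W ** B ** transpose W) ^ CARD('m)"
    by (simp add: det_kronecker_diag_mat V W)
  finally show ?thesis unfolding cong[OF V(1)] cong[OF W(1)] .
qed

text \<open>A congruence taking \<open>S\<close> to the identity gives (det V)^2 det S = 1.\<close>

lemma spd_det_pos:
  fixes S :: "real^'n^'n"
  assumes "S \<in> sym_pos_def"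
  shows "0 < det S"
proof -
  have "transpose S = S" using assms by (simp add: sym_pos_def_def)
  then obtain V :: "real^'n^'n" where "V ** S ** transpose V = mat 1"
    by (rule simultaneous_diagonalization[OF assms])
  then have "det (V ** S ** transpose V) = 1" by simp
  then have "(det V)\<^sup>2 * det S = 1" by (simp add: det_mul power2_eq_square mult_ac)
  then show ?thesis by (metis zero_less_mult_pos zero_less_one zero_less_power2 mult_zero_left power_zero_numeral zero_neq_one)
qed

lemma det_kronecker_spd:
  fixes A :: "real^'m^'m" and B :: "real^'n^'n"
  assumes "A \<in> sym_pos_def" "B \<in> sym_pos_def"
  shows "det (kronecker A B) = det A ^ CARD('n) * det B ^ CARD('m)"
  using assms by (intro det_kronecker_symmetric) (simp_all add: sym_pos_def_def)

lemma det_kronecker_pos: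
  assumes "A \<in> sym_pos_def" "B \<in> sym_pos_def"
  shows "0 < det (kronecker A B)"
  using assms by (simp add: det_kronecker_spd spd_det_pos)

subsection \<open>The likelihood as a function of the precision matrices\<close>

definition precision_loglik :: "real^'m^'m \<Rightarrow> real^'m^'m \<Rightarrow> real^'m^'m \<Rightarrow> real" where
  "precision_loglik A B Y = trace (A ** Y ** B ** transpose Y) - ln (det (kronecker B A))"

definition loglik_values :: "(real^'m^'m) set \<Rightarrow> real^'m^'m \<Rightarrow> real set" where
  "loglik_values P Y = {precision_loglik A B Y | A B. A \<in> P \<and> B \<in> P}"

lemma loglik_valuesI: "A \<in> P \<Longrightarrow> B \<in> P \<Longrightarrow> precision_loglik A B Y \<in> loglik_values P Y"
  by (auto simp: loglik_values_def)

text \<open>Attained minima are tracked by their value because minimizers are not unique: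
  \<open>(c A, B / c)\<close> has the same likelihood as \<open>(A, B)\<close>.\<close>

definition is_min_value :: "(real^'m^'m) set \<Rightarrow> real^'m^'m \<Rightarrow> real \<Rightarrow> bool" where
  "is_min_value P Y v \<longleftrightarrow> v \<in> loglik_values P Y \<and> (\<forall>w\<in>loglik_values P Y. v \<le> w)"

lemma is_min_value_unique: "is_min_value P Y v \<Longrightarrow> is_min_value P Y w \<Longrightarrow> v = w"
  by (force simp: is_min_value_def)

lemma scaled_loglik_precision: "scaled_loglik Sr Sc Y = precision_loglik (matrix_inv Sr) (matrix_inv Sc) Y"
  by (simp add: scaled_loglik_def precision_loglik_def)

lemma is_minimizer_iff:
  "is_minimizer P Y (Sr, Sc) \<longleftrightarrow>
    Sr \<in> P \<and> Sc \<in> P \<and> (\<forall>S\<in>P. \<forall>T\<in>P. scaled_loglik Sr Sc Y \<le> scaled_loglik S T Y)"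
  by (auto simp: is_minimizer_def is_arg_min_linorder)

text \<open>Inversion is an involution of \<open>P\<close>, so covariance and precision matrices
  from \<open>P\<close> yield the same set of likelihood values.\<close>

lemma is_min_value_iff_minimizer:
  assumes P: "P \<subseteq> sym_pos_def" and inv: "\<And>A. A \<in> P \<Longrightarrow> matrix_inv A \<in> P"
  shows "is_min_value P Y v \<longleftrightarrow> (\<exists>Sr Sc. is_minimizer P Y (Sr, Sc) \<and> v = scaled_loglik Sr Sc Y)"
proof -
  have "matrix_inv (matrix_inv A) = A" if "A \<in> P" for A
    using that P by (auto intro: matrix_inv_matrix_inv spd_invertible)
  then have image: "matrix_inv ` P = P"
    using inv by (metis (no_types, lifting) image_eqI image_subsetI subsetI subset_antisym)
  have vals: "loglik_values P Y = {scaled_loglik S T Y | S T. S \<in> P \<and> T \<in> P}"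
  proof -
    have "loglik_values P Y = {precision_loglik A B Y | A B. A \<in> matrix_inv ` P \<and> B \<in> matrix_inv ` P}"
      by (simp add: loglik_values_def image)
    also have "\<dots> = {scaled_loglik S T Y | S T. S \<in> P \<and> T \<in> P}"
      by (auto simp: scaled_loglik_precision)
    finally show ?thesis .
  qed
  show ?thesis unfolding is_min_value_def vals is_minimizer_iff by blast
qed

lemma is_min_value_pos_diag:
  "is_min_value pos_diag Y v \<longleftrightarrow> (\<exists>Sr Sc. is_minimizer pos_diag Y (Sr, Sc) \<and> v = scaled_loglik Sr Sc Y)"
  by (rule is_min_value_iff_minimizer) (simp_all add: pos_diag_subset_sym_pos_def pos_diag_matrix_inv)

lemma is_min_value_sym_pos_def:
  "is_min_value sym_pos_def Y v \<longleftrightarrow> (\<exists>Sr Sc. is_minimizer sym_pos_def Y (Sr, Sc) \<and> v = scaled_loglik Sr Sc Y)"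
  by (rule is_min_value_iff_minimizer) (simp_all add: spd_matrix_inv)

lemma minimizers_exist_iff:
  "minimizers_exist Y \<longleftrightarrow> (\<exists>u. is_min_value pos_diag Y u) \<and> (\<exists>v. is_min_value sym_pos_def Y v)"
  unfolding minimizers_exist_def is_min_value_pos_diag is_min_value_sym_pos_def by auto

lemma lr_stat_eq:
  "lr_stat Y = (THE t. \<exists>u v. is_min_value pos_diag Y u \<and> is_min_value sym_pos_def Y v \<and> t = u - v)"
  unfolding lr_stat_def is_min_value_pos_diag is_min_value_sym_pos_def
  by (rule arg_cong[where f=The]) blast

lemma lr_stat_if_min_values:
  assumes "is_min_value pos_diag Y u" "is_min_value sym_pos_def Y v"
  shows "lr_stat Y = u - v"
  unfolding lr_stat_eq using assms by (blast intro: the_equality dest: is_min_value_unique)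

text \<open>No \<open>t\<close> satisfies the description, so its value is one fixed number for all
  such \<open>Y\<close>. This makes the invariance of \<open>lr_stat\<close> hold everywhere and
  helps with measurability.\<close>

lemma lr_stat_if_no_minimizers:
  assumes "\<not> minimizers_exist Y"
  shows "lr_stat Y = (THE t. False)"
  using assms unfolding lr_stat_eq minimizers_exist_iff by (intro arg_cong[where f=The]) blast

subsection \<open>Invariance under positive diagonal scaling\<close>

text \<open>Cyclicity of the trace moves the trailing \<open>D1\<close> to the front. In the
  determinant, the mixed-product rule splits off \<open>kronecker D2 D1\<close> once on each side,
  whence the factor 2.\<close>

lemma precision_loglik_scale:
  assumes A: "A \<in> sym_pos_def" and B: "B \<in> sym_pos_def" and D: "D1 \<in> pos_diag" "D2 \<in> pos_diag"
  shows "precision_loglik A B (D1 ** Y ** D2) =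
    precision_loglik (D1 ** A ** D1) (D2 ** B ** D2) Y + 2 * ln (det (kronecker D2 D1))"
proof -
  have t: "transpose D1 = D1" "transpose D2 = D2" using D by (auto elim!: pos_diagE)
  have "trace (A ** (D1 ** Y ** D2) ** B ** transpose (D1 ** Y ** D2)) =
      trace ((A ** D1 ** Y ** D2 ** B ** D2 ** transpose Y) ** D1)"
    by (simp add: matrix_transpose_mul t matrix_mul_assoc)
  also have "\<dots> = trace (D1 ** (A ** D1 ** Y ** D2 ** B ** D2 ** transpose Y))"
    by (rule trace_mul_sym)
  finally have tr: "trace (A ** (D1 ** Y ** D2) ** B ** transpose (D1 ** Y ** D2)) =
      trace (D1 ** A ** D1 ** Y ** (D2 ** B ** D2) ** transpose Y)"
    by (simp add: matrix_mul_assoc)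
  have pos: "0 < det (kronecker D2 D1)" "0 < det (kronecker B A)"
    using D A B pos_diag_subset_sym_pos_def by (blast intro: det_kronecker_pos)+
  have "det (kronecker (D2 ** B ** D2) (D1 ** A ** D1)) =
      det (kronecker D2 D1) * det (kronecker B A) * det (kronecker D2 D1)"
    by (simp add: kronecker_mult det_mul)
  then have "ln (det (kronecker (D2 ** B ** D2) (D1 ** A ** D1))) =
      ln (det (kronecker B A)) + 2 * ln (det (kronecker D2 D1))"
    using pos by (simp add: ln_mult)
  then show ?thesis by (simp add: precision_loglik_def tr)
qed

text \<open>Congruence by \<open>D\<close> is a bijection of \<open>P\<close>, with congruence by
  the inverse of \<open>D\<close> as its inverse; hence the whole set of values is translated by a
  constant.\<close>

lemma is_min_value_scale:
  assumes P: "P \<subseteq> sym_pos_def" and cong: "\<And>A D. A \<in> P \<Longrightarrow> D \<in> pos_diag \<Longrightarrow> D ** A ** D \<in> P"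
    and D: "D1 \<in> pos_diag" "D2 \<in> pos_diag"
  shows "is_min_value P (D1 ** Y ** D2) v \<longleftrightarrow> is_min_value P Y (v - 2 * ln (det (kronecker D2 D1)))"
proof -
  define k where "k = 2 * ln (det (kronecker D2 D1))"
  have surj: "\<exists>A'\<in>P. D ** A' ** D = A" if "A \<in> P" "D \<in> pos_diag" for A D :: "real^'a^'a"
  proof
    have "invertible D" using that pos_diag_subset_sym_pos_def by (blast intro: spd_invertible)
    note inv = matrix_inv_mult[OF this]
    have "D ** (matrix_inv D ** A ** matrix_inv D) ** D = (D ** matrix_inv D) ** A ** (matrix_inv D ** D)"
      by (simp only: matrix_mul_assoc)
    then show "D ** (matrix_inv D ** A ** matrix_inv D) ** D = A" by (simp add: inv)
    show "matrix_inv D ** A ** matrix_inv D \<in> P" using that by (intro cong pos_diag_matrix_inv)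
  qed
  have scale: "precision_loglik A B (D1 ** Y ** D2) = precision_loglik (D1 ** A ** D1) (D2 ** B ** D2) Y + k"
    if "A \<in> P" "B \<in> P" for A B
    using that P D by (auto simp: k_def intro: precision_loglik_scale)
  have "loglik_values P (D1 ** Y ** D2) = (\<lambda>x. x + k) ` loglik_values P Y"
  proof (intro equalityI subsetI)
    fix x assume "x \<in> loglik_values P (D1 ** Y ** D2)"
    then obtain A B where "A \<in> P" "B \<in> P" "x = precision_loglik A B (D1 ** Y ** D2)"
      by (auto simp: loglik_values_def)
    then show "x \<in> (\<lambda>x. x + k) ` loglik_values P Y"
      using D by (auto simp: scale intro!: imageI loglik_valuesI cong)
  next
    fix x assume "x \<in> (\<lambda>x. x + k) ` loglik_values P Y"
    then obtain A B where AB: "A \<in> P" "B \<in> P" "x = precision_loglik A B Y + k"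
      by (auto simp: loglik_values_def)
    obtain A' B' where "A' \<in> P" "D1 ** A' ** D1 = A" "B' \<in> P" "D2 ** B' ** D2 = B"
      using surj AB D by metis
    then show "x \<in> loglik_values P (D1 ** Y ** D2)"
      using scale[of A' B'] AB by (metis loglik_valuesI)
  qed
  then have "is_min_value P (D1 ** Y ** D2) v \<longleftrightarrow> is_min_value P Y (v - k)"
    unfolding is_min_value_def by (force simp: image_iff algebra_simps)
  then show ?thesis by (simp add: k_def)
qed

lemma pos_diag_congruence:
  assumes "A \<in> pos_diag" "D \<in> pos_diag"
  shows "D ** A ** D \<in> pos_diag"
  using assms by (elim pos_diagE) (simp add: diag_mat_mult)

lemma spd_diag_congruence:
  assumes "A \<in> sym_pos_def" "D \<in> pos_diag"
  shows "D ** A ** D \<in> sym_pos_def"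
proof -
  have "transpose D = D" using assms(2) by (auto elim!: pos_diagE)
  moreover have "invertible D" using assms(2) pos_diag_subset_sym_pos_def by (blast intro: spd_invertible)
  ultimately show ?thesis using spd_congruence[OF assms(1)] by metis
qed

lemma is_min_value_scale_pos_diag:
  assumes "D1 \<in> pos_diag" "D2 \<in> pos_diag"
  shows "is_min_value pos_diag (D1 ** Y ** D2) v \<longleftrightarrow> is_min_value pos_diag Y (v - 2 * ln (det (kronecker D2 D1)))"
  using assms by (intro is_min_value_scale) (simp_all add: pos_diag_subset_sym_pos_def pos_diag_congruence)

lemma is_min_value_scale_sym_pos_def:
  assumes "D1 \<in> pos_diag" "D2 \<in> pos_diag"
  shows "is_min_value sym_pos_def (D1 ** Y ** D2) v \<longleftrightarrow> is_min_value sym_pos_def Y (v - 2 * ln (det (kronecker D2 D1)))"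
  using assms by (intro is_min_value_scale) (simp_all add: spd_diag_congruence)

lemma minimizers_exist_scale:
  assumes "D1 \<in> pos_diag" "D2 \<in> pos_diag"
  shows "minimizers_exist (D1 ** Y ** D2) \<longleftrightarrow> minimizers_exist Y"
  unfolding minimizers_exist_iff is_min_value_scale_pos_diag[OF assms] is_min_value_scale_sym_pos_def[OF assms]
  by (metis add_diff_cancel_right')

lemma lr_stat_scale:
  assumes "D1 \<in> pos_diag" "D2 \<in> pos_diag"
  shows "lr_stat (D1 ** Y ** D2) = lr_stat Y"
proof (cases "minimizers_exist Y")
  case True
  then obtain u v where uv: "is_min_value pos_diag Y u" "is_min_value sym_pos_def Y v"
    unfolding minimizers_exist_iff by blast
  define k where "k = 2 * ln (det (kronecker D2 D1))"
  have "lr_stat (D1 ** Y ** D2) = (u + k) - (v + k)"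
    by (rule lr_stat_if_min_values)
      (simp_all add: is_min_value_scale_pos_diag[OF assms] is_min_value_scale_sym_pos_def[OF assms] k_def uv)
  then show ?thesis using lr_stat_if_min_values[OF uv] by simp
next
  case False
  then show ?thesis using assms by (simp add: lr_stat_if_no_minimizers minimizers_exist_scale)
qed

subsection \<open>Existence of the minimizers\<close>

text \<open>With d_i the diagonalized entries, the likelihood is the sum of the d_i - m ln d_i plus
  m ln((det Y)^2), and each of the m summands is least at d_i = m.\<close>

lemma precision_loglik_lower_bound:
  fixes Y :: "real^'m^'m"
  assumes Y: "det Y \<noteq> 0" and A: "A \<in> sym_pos_def" and B: "B \<in> sym_pos_def"
  defines "m \<equiv> real CARD('m)"
  shows "m\<^sup>2 - m\<^sup>2 * ln m + m * ln ((det Y)\<^sup>2) \<le> precision_loglik A B Y"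
proof -
  have m: "0 < m" by (simp add: m_def)
  define C where "C = Y ** B ** transpose Y"
  have C: "C \<in> sym_pos_def" unfolding C_def using B Y by (intro spd_congruence) (simp_all add: invertible_det_nz)
  define S where "S = matrix_inv A"
  have S: "S \<in> sym_pos_def" unfolding S_def by (rule spd_matrix_inv[OF A])
  have tC: "transpose C = C" using C by (simp add: sym_pos_def_def)
  obtain V :: "real^'m^'m" and d where V: "V ** S ** transpose V = mat 1" "V ** C ** transpose V = diag_mat d"
    by (rule simultaneous_diagonalization[OF S tC])
  \<comment> \<open>For square matrices one-sided inverses are two-sided, so normalizing
    \<open>S\<close> to the identity yields the factorization
    \<open>A = transpose V ** V\<close>.\<close>
  have "transpose V ** (V ** S) = mat 1" using V(1) by (rule iffD1[OF matrix_left_right_inverse])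
  then have "(transpose V ** V) ** S = mat 1" by (simp only: matrix_mul_assoc)
  then have "S ** (transpose V ** V) = mat 1" by (rule iffD1[OF matrix_left_right_inverse])
  then have "matrix_inv S = transpose V ** V" by (rule matrix_inv_unique)
  then have AV: "A = transpose V ** V"
    using matrix_inv_matrix_inv[OF spd_invertible[OF A]] by (simp add: S_def)
  have "0 < det A" by (rule spd_det_pos[OF A])
  then have "invertible V" by (auto simp: AV det_mul invertible_det_nz)
  then have "diag_mat d \<in> sym_pos_def" using spd_congruence[OF C] V(2) by metis
  then have d: "0 < d $ i" for i
  proof -
    have "0 < axis i 1 \<bullet> (diag_mat d *v axis i 1)"
      using \<open>diag_mat d \<in> sym_pos_def\<close> by (simp add: sym_pos_def_def)
    then show ?thesis by (simp add: diag_mat_mult_vec inner_axis')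
  qed
  have "trace (A ** Y ** B ** transpose Y) = trace (transpose V ** (V ** C))"
    by (simp add: AV C_def matrix_mul_assoc)
  also have "\<dots> = trace (V ** C ** transpose V)" by (rule trace_mul_sym)
  finally have tr: "trace (A ** Y ** B ** transpose Y) = (\<Sum>i\<in>UNIV. d $ i)"
    by (simp add: V trace_def diag_mat_nth)
  have "det (diag_mat d) = det A * det B * (det Y)\<^sup>2"
    by (simp add: V(2)[symmetric] C_def AV det_mul power2_eq_square mult_ac)
  then have "ln (\<Prod>i\<in>UNIV. d $ i) = ln (det A) + ln (det B) + ln ((det Y)\<^sup>2)"
    using Y spd_det_pos[OF A] spd_det_pos[OF B] by (simp add: det_diag_mat ln_mult)
  moreover have "ln (\<Prod>i\<in>UNIV. d $ i) = (\<Sum>i\<in>UNIV. ln (d $ i))"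
    by (intro ln_prod) (simp_all add: less_imp_neq[OF d, symmetric])
  moreover have "ln (det (kronecker B A)) = m * ln (det B) + m * ln (det A)"
    using spd_det_pos[OF A] spd_det_pos[OF B] by (simp add: det_kronecker_spd A B ln_mult ln_realpow m_def)
  ultimately have val: "precision_loglik A B Y = (\<Sum>i\<in>UNIV. d $ i) - m * (\<Sum>i\<in>UNIV. ln (d $ i)) + m * ln ((det Y)\<^sup>2)"
    unfolding precision_loglik_def tr by (simp add: algebra_simps)
  have "m - m * ln m \<le> d $ i - m * ln (d $ i)" for i
  proof -
    \<comment> \<open>The tangent to the logarithm at 1, scaled so that equality occurs at d_i =
      m.\<close>
    have "ln (d $ i / m) \<le> d $ i / m - 1" using d m by (intro ln_le_minus_one) simp
    then have "m * ln (d $ i / m) \<le> m * (d $ i / m - 1)" using m by (intro mult_left_mono) auto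
    then show ?thesis using d[of i] m by (simp add: ln_div algebra_simps)
  qed
  then have "(\<Sum>i::'m\<in>UNIV. m - m * ln m) \<le> (\<Sum>i\<in>UNIV. d $ i - m * ln (d $ i))" by (rule sum_mono)
  then show ?thesis
    unfolding val by (simp add: m_def[symmetric] sum_subtractf sum_distrib_left power2_eq_square algebra_simps)
qed

text \<open>The lower bound is attained at an explicit point: for \<open>B = mat 1\<close> and A = m
  (Y Y^t)^{-1} the product A Y Y^t is m times the identity.\<close>

lemma exists_min_value_sym_pos_def:
  fixes Y :: "real^'m^'m"
  assumes Y: "det Y \<noteq> 0"
  shows "\<exists>v. is_min_value sym_pos_def Y v"
proof -
  define m where "m = real CARD('m)"
  have m: "0 < m" by (simp add: m_def)
  define A where "A = m *\<^sub>R matrix_inv (Y ** transpose Y)"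
  have YY: "Y ** transpose Y \<in> sym_pos_def"
    using spd_congruence[OF sym_pos_def_mat_1, of Y] Y by (simp add: invertible_det_nz)
  note inv = matrix_inv_mult[OF spd_invertible[OF YY]]
  have A: "A \<in> sym_pos_def"
    using spd_matrix_inv[OF YY] m
    by (simp add: A_def sym_pos_def_def transpose_scalar scaleR_matrix_vector_assoc[symmetric])
  have AYY: "A ** (Y ** transpose Y) = m *\<^sub>R mat 1"
    by (simp add: A_def scalar_matrix_assoc[symmetric] inv)
  then have "A ** Y ** mat 1 ** transpose Y = m *\<^sub>R mat 1" by (simp add: matrix_mul_assoc)
  then have tr: "trace (A ** Y ** mat 1 ** transpose Y) = m\<^sup>2"
    by (simp add: trace_def) (simp add: mat_def m_def power2_eq_square)
  have "(m *\<^sub>R mat 1 :: real^'m^'m) = diag_mat (\<chi> i. m)"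
    by (simp add: vec_eq_iff mat_def diag_mat_nth)
  then have "det A * (det Y)\<^sup>2 = m ^ CARD('m)"
    using arg_cong[OF AYY, of det] by (simp add: det_mul det_diag_mat power2_eq_square mult_ac)
  then have "ln (det A) + ln ((det Y)\<^sup>2) = m * ln m"
    using spd_det_pos[OF A] Y m by (metis ln_mult ln_realpow m_def less_numeral_extra(3) zero_less_power2)
  moreover have "ln (det (kronecker (mat 1 :: real^'m^'m) A)) = m * ln (det A)"
    using spd_det_pos[OF A] by (simp add: det_kronecker_spd A ln_realpow m_def)
  ultimately have "precision_loglik A (mat 1) Y = m\<^sup>2 - m * (m * ln m - ln ((det Y)\<^sup>2))"
    unfolding precision_loglik_def tr by simp
  then have "precision_loglik A (mat 1) Y = m\<^sup>2 - m\<^sup>2 * ln m + m * ln ((det Y)\<^sup>2)"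
    by (simp add: power2_eq_square algebra_simps)
  then have "is_min_value sym_pos_def Y (precision_loglik A (mat 1) Y)"
    using precision_loglik_lower_bound[OF Y] loglik_valuesI[OF A sym_pos_def_mat_1, of Y]
    unfolding is_min_value_def loglik_values_def m_def by force
  then show ?thesis ..
qed

section \<open>The diagonal minimum, as a problem about the products a_i b_j\<close>

lemma precision_loglik_diag_mat:
  fixes Y :: "real^'m^'m"
  assumes "\<And>i. 0 < a $ i" "\<And>j. 0 < b $ j"
  shows "precision_loglik (diag_mat a) (diag_mat b) Y =
    (\<Sum>i\<in>UNIV. \<Sum>j\<in>UNIV. a $ i * b $ j * (Y $ i $ j)\<^sup>2 - ln (a $ i * b $ j))"
proof -
  have "(X ** transpose Y) $ i $ i = (\<Sum>j\<in>UNIV. X $ i $ j * Y $ i $ j)" for X :: "real^'m^'m" and i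
    by (simp add: matrix_matrix_mult_def transpose_def)
  then have "trace (diag_mat a ** Y ** diag_mat b ** transpose Y) =
      (\<Sum>i\<in>UNIV. \<Sum>j\<in>UNIV. (diag_mat a ** Y ** diag_mat b) $ i $ j * Y $ i $ j)"
    by (simp add: trace_def)
  also have "\<dots> = (\<Sum>i\<in>UNIV. \<Sum>j\<in>UNIV. a $ i * b $ j * (Y $ i $ j)\<^sup>2)"
    by (simp add: mul_diag_mat_nth diag_mat_mul_nth power2_eq_square mult_ac)
  finally have tr: "trace (diag_mat a ** Y ** diag_mat b ** transpose Y) = \<dots>" .
  have "ln (det (kronecker (diag_mat b) (diag_mat a))) = (\<Sum>p\<in>UNIV. ln (b $ fst p * a $ snd p))"
    unfolding kronecker_diag_mat det_diag_mat
    by (subst ln_prod) (simp_all add: less_imp_neq[OF assms(1), symmetric] less_imp_neq[OF assms(2), symmetric])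
  also have "\<dots> = (\<Sum>j\<in>UNIV. \<Sum>i\<in>UNIV. ln (b $ j * a $ i))"
    unfolding UNIV_Times_UNIV[symmetric] sum.cartesian_product by (simp add: case_prod_beta)
  also have "\<dots> = (\<Sum>i\<in>UNIV. \<Sum>j\<in>UNIV. ln (a $ i * b $ j))"
    by (subst sum.swap) (simp add: mult.commute)
  finally show ?thesis by (simp add: precision_loglik_def tr sum_subtractf)
qed

text \<open>The function u w - ln u tends to infinity at both ends of the positive
  half-line.\<close>

lemma linear_minus_ln_sublevel_bounded:
  fixes w M :: real
  assumes "0 < w"
  obtains \<alpha> \<beta> where "0 < \<alpha>" "\<And>u. 0 < u \<Longrightarrow> u * w - ln u \<le> M \<Longrightarrow> \<alpha> \<le> u \<and> u \<le> \<beta>"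
proof
  show "0 < exp (- M)" by simp
  fix u :: real assume u: "0 < u" "u * w - ln u \<le> M"
  have "0 < u * w" using assms u(1) by simp
  then have "- M \<le> ln u" using u by linarith
  then have "exp (- M) \<le> u" using u(1) by (metis exp_le_cancel_iff exp_ln)
  \<comment> \<open>Using the logarithm bound at \<open>u * w / 2\<close> instead of
    \<open>u * w\<close> leaves half of the linear term to bound \<open>u\<close> from
    above.\<close>
  moreover have "ln (u * w / 2) \<le> u * w / 2 - 1" using assms u by (intro ln_le_minus_one) simp
  then have "ln u + ln (w / 2) \<le> u * w / 2 - 1" using assms u by (simp add: ln_mult ln_div)
  then have "u * w \<le> 2 * (M - 1 - ln (w / 2))" using u(2) by argo
  then have "u \<le> 2 * (M - 1 - ln (w / 2)) / w" using assms by (simp add: pos_le_divide_eq)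
  ultimately show "exp (- M) \<le> u \<and> u \<le> 2 * (M - 1 - ln (w / 2)) / w" ..
qed

text \<open>The objective depends on \<open>a\<close> and \<open>b\<close> only through the products \<open>a\<^sub>i b\<^sub>j\<close>, so that one entry of
  \<open>a\<close> may be normalized to \<open>1\<close>; sublevel sets of the normalized problem are compact.\<close>

lemma exists_min_scaling:
  fixes w :: "'m::finite \<Rightarrow> 'm \<Rightarrow> real"
  assumes w: "\<And>i j. 0 < w i j"
  defines "f \<equiv> \<lambda>(a::real^'m) (b::real^'m). \<Sum>i\<in>UNIV. \<Sum>j\<in>UNIV. a $ i * b $ j * w i j - ln (a $ i * b $ j)"
  obtains a b where "\<And>i. 0 < a $ i" "\<And>j. 0 < b $ j"
    "\<And>a' b'. (\<And>i. 0 < a' $ i) \<Longrightarrow> (\<And>j. 0 < b' $ j) \<Longrightarrow> f a b \<le> f a' b'"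
proof -
  \<comment> \<open>The smallest weight gives one pair of bounds \<alpha>, \<beta> valid for all
    index pairs.\<close>
  define w0 where "w0 = Min (range (\<lambda>p. w (fst p) (snd p)))"
  have "w0 \<in> range (\<lambda>p. w (fst p) (snd p))" unfolding w0_def by (intro Min_in) auto
  then have w0: "0 < w0" using w by auto
  have w0_le: "w0 \<le> w i j" for i j
    unfolding w0_def by (intro Min_le) (auto intro!: image_eqI[where x="(i, j)"])
  define h where "h = (\<lambda>i j u. u * w i j - ln u)"
  \<comment> \<open>The value \<open>g i j\<close> is the minimum of \<open>h i j\<close> on the
    positive reals, reached at u = 1 / w_ij.\<close>
  define g where "g = (\<lambda>i j. 1 + ln (w i j))"
  have h_ge: "g i j \<le> h i j u" if "0 < u" for i j u
  proof -
    have "ln (u * w i j) \<le> u * w i j - 1" using that w by (intro ln_le_minus_one) simp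
    then show ?thesis using that w[of i j] by (simp add: ln_mult g_def h_def)
  qed
  have f_h: "f a b = (\<Sum>p\<in>UNIV. h (fst p) (snd p) (a $ fst p * b $ snd p))" for a b
    unfolding f_def h_def UNIV_Times_UNIV[symmetric] sum.cartesian_product by (simp add: case_prod_beta)
  define one :: "real^'m" where "one = (\<chi> i. 1)"
  \<comment> \<open>If \<open>f a b\<close> does not exceed its value at \<open>one\<close>, every
    single summand is at most \<open>M\<close>, because the other summands are bounded below through
    \<open>g\<close>.\<close>
  define M where "M = f one one + (\<Sum>p\<in>UNIV. \<bar>g (fst p) (snd p)\<bar>)"
  obtain \<alpha> \<beta> where ab: "0 < \<alpha>" "\<And>u. 0 < u \<Longrightarrow> u * w0 - ln u \<le> M \<Longrightarrow> \<alpha> \<le> u \<and> u \<le> \<beta>"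
    using linear_minus_ln_sublevel_bounded[OF w0] by metis
  have products_bounded: "\<alpha> \<le> a $ i * b $ j \<and> a $ i * b $ j \<le> \<beta>"
    if a: "\<And>i. 0 < a $ i" and b: "\<And>j. 0 < b $ j" and le: "f a b \<le> f one one" for a b i j
  proof (rule ab(2))
    let ?u = "\<lambda>p. a $ fst p * b $ snd p"
    show "0 < a $ i * b $ j" using a b by simp
    have "(\<Sum>p\<in>UNIV - {(i, j)}. h (fst p) (snd p) (?u p)) \<ge> (\<Sum>p\<in>UNIV - {(i, j)}. - \<bar>g (fst p) (snd p)\<bar>)"
    proof (rule sum_mono)
      fix p :: "'m \<times> 'm"
      have "g (fst p) (snd p) \<le> h (fst p) (snd p) (?u p)" using a b by (intro h_ge) simp
      then show "- \<bar>g (fst p) (snd p)\<bar> \<le> h (fst p) (snd p) (?u p)" by linarith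
    qed
    moreover have "(\<Sum>p\<in>UNIV - {(i, j)}. \<bar>g (fst p) (snd p)\<bar>) \<le> (\<Sum>p\<in>UNIV. \<bar>g (fst p) (snd p)\<bar>)"
      by (intro sum_mono2) auto
    moreover have "f a b = h i j (a $ i * b $ j) + (\<Sum>p\<in>UNIV - {(i, j)}. h (fst p) (snd p) (?u p))"
      unfolding f_h by (subst sum.remove[where x="(i, j)"]) auto
    ultimately have "h i j (a $ i * b $ j) \<le> M" using le by (simp add: M_def sum_negf)
    moreover have "a $ i * b $ j * w0 \<le> a $ i * b $ j * w i j"
      using a[of i] b[of j] by (intro mult_left_mono w0_le) simp
    ultimately show "a $ i * b $ j * w0 - ln (a $ i * b $ j) \<le> M" by (simp add: h_def)
  qed
  have "\<alpha> \<le> 1 \<and> 1 \<le> \<beta>"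
    using products_bounded[of one one] by (simp add: one_def)
  then have beta: "1 \<le> \<beta>" by simp
  \<comment> \<open>Once an entry of \<open>a\<close> is 1, the entries of \<open>b\<close> are
    themselves products and lie in [\<alpha>, \<beta>]; dividing products by them puts the entries
    of \<open>a\<close> in [\<alpha>/\<beta>, \<beta>/\<alpha>]. The box covers both ranges.\<close>
  define lo hi where "lo = min \<alpha> (\<alpha> / \<beta>)" and "hi = max \<beta> (\<beta> / \<alpha>)"
  have lo: "0 < lo" using ab(1) beta by (simp add: lo_def)
  define K :: "((real^'m) \<times> (real^'m)) set" where
    "K = cbox (\<chi> i. lo, \<chi> i. lo) (\<chi> i. hi, \<chi> i. hi)"
  have K_iff: "(a, b) \<in> K \<longleftrightarrow> (\<forall>i. lo \<le> a $ i \<and> a $ i \<le> hi) \<and> (\<forall>i. lo \<le> b $ i \<and> b $ i \<le> hi)" for a b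
    by (simp add: K_def cbox_Pair_iff mem_box_cart)
  have oneK: "(one, one) \<in> K"
    using \<open>\<alpha> \<le> 1 \<and> 1 \<le> \<beta>\<close> by (auto simp: K_iff one_def lo_def hi_def)
  have posK: "0 < a $ i \<and> 0 < b $ i" if "(a, b) \<in> K" for a b i
  proof -
    have "lo \<le> a $ i" "lo \<le> b $ i" using that by (simp_all add: K_iff)
    then show ?thesis using lo by simp
  qed
  then have nz: "fst q $ i * snd q $ j \<noteq> 0" if "q \<in> K" for q i j
    using that by (metis less_irrefl mult_pos_pos prod.collapse)
  have "compact K" unfolding K_def by (rule compact_cbox)
  moreover have "continuous_on K (\<lambda>q. f (fst q) (snd q))"
    unfolding f_def by (intro continuous_intros ballI nz)
  ultimately obtain p where p: "p \<in> K" "\<forall>q\<in>K. f (fst p) (snd p) \<le> f (fst q) (snd q)"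
    using continuous_attains_inf[of K "\<lambda>q. f (fst q) (snd q)"] oneK by fastforce
  obtain a b where p_eq: "p = (a, b)" by (cases p)
  show ?thesis
  proof
    show "0 < a $ i" "0 < b $ i" for i using posK[of a b i] p(1) by (simp_all add: p_eq)
    fix a' b' :: "real^'m" assume a': "\<And>i. 0 < a' $ i" and b': "\<And>j. 0 < b' $ j"
    show "f a b \<le> f a' b'"
    proof (cases "f a' b' \<le> f one one")
      case True
      \<comment> \<open>An arbitrary index: dividing \<open>a'\<close> by its entry there and
        multiplying \<open>b'\<close> by it preserves all products and makes that entry of
        \<open>a2\<close> equal to 1.\<close>
      define i0 :: 'm where "i0 = undefined"
      define c where "c = a' $ i0"
      have c: "0 < c" using a' by (simp add: c_def)
      define a2 b2 where "a2 = (\<chi> i. a' $ i / c)" and "b2 = (\<chi> j. c * b' $ j)"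
      have prod_eq: "a2 $ i * b2 $ j = a' $ i * b' $ j" for i j using c by (simp add: a2_def b2_def)
      have b2: "\<alpha> \<le> b2 $ j \<and> b2 $ j \<le> \<beta>" for j
        using products_bounded[OF a' b' True, of i0 j] by (simp add: b2_def c_def)
      have a2: "\<alpha> / \<beta> \<le> a2 $ i \<and> a2 $ i \<le> \<beta> / \<alpha>" for i
      proof -
        have pb: "\<alpha> \<le> a2 $ i * b2 $ i0 \<and> a2 $ i * b2 $ i0 \<le> \<beta>"
          unfolding prod_eq by (rule products_bounded[OF a' b' True])
        have pos: "0 \<le> a2 $ i" using a'[of i] c by (simp add: a2_def)
        have "a2 $ i * b2 $ i0 \<le> a2 $ i * \<beta>" "a2 $ i * \<alpha> \<le> a2 $ i * b2 $ i0"
          using b2[of i0] pos by (simp_all add: mult_left_mono)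
        then show ?thesis using pb ab(1) beta by (simp add: pos_divide_le_eq pos_le_divide_eq)
      qed
      have "(a2, b2) \<in> K"
        unfolding K_iff lo_def hi_def by (simp add: min.coboundedI1 min.coboundedI2 max.coboundedI1 max.coboundedI2 a2 b2)
      then have "f a b \<le> f a2 b2" using bspec[OF p(2) \<open>(a2, b2) \<in> K\<close>] by (simp add: p_eq)
      also have "\<dots> = f a' b'" by (simp add: f_def prod_eq)
      finally show ?thesis .
    next
      \<comment> \<open>Outside the sublevel set the comparison goes through \<open>one\<close>,
        which lies in the box.\<close>
      case False
      then show ?thesis using bspec[OF p(2) oneK] by (simp add: p_eq)
    qed
  qed
qed

lemma exists_min_value_pos_diag:
  fixes Y :: "real^'m^'m"
  assumes Y: "\<And>i j. Y $ i $ j \<noteq> 0"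
  shows "\<exists>v. is_min_value pos_diag Y v"
proof -
  have w: "0 < (Y $ i $ j)\<^sup>2" for i j using Y by simp
  show ?thesis
  proof (rule exists_min_scaling[of "\<lambda>i j. (Y $ i $ j)\<^sup>2", OF w])
    fix a b :: "real^'m"
    assume a: "\<And>i. 0 < a $ i" and b: "\<And>j. 0 < b $ j" and le:
      "\<And>a' b'. (\<And>i. 0 < a' $ i) \<Longrightarrow> (\<And>j. 0 < b' $ j) \<Longrightarrow>
        (\<Sum>i\<in>UNIV. \<Sum>j\<in>UNIV. a $ i * b $ j * (Y $ i $ j)\<^sup>2 - ln (a $ i * b $ j)) \<le>
        (\<Sum>i\<in>UNIV. \<Sum>j\<in>UNIV. a' $ i * b' $ j * (Y $ i $ j)\<^sup>2 - ln (a' $ i * b' $ j))"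
    have "precision_loglik (diag_mat a) (diag_mat b) Y \<le> precision_loglik A B Y"
      if A: "A \<in> pos_diag" and B: "B \<in> pos_diag" for A B
    proof -
      obtain a' where a': "A = diag_mat a'" "\<And>i. 0 < a' $ i" using A by (rule pos_diagE) blast
      obtain b' where b': "B = diag_mat b'" "\<And>i. 0 < b' $ i" using B by (rule pos_diagE) blast
      show ?thesis unfolding a'(1) b'(1) precision_loglik_diag_mat[OF a b] precision_loglik_diag_mat[OF a'(2) b'(2)]
        by (rule le[OF a'(2) b'(2)])
    qed
    moreover have "precision_loglik (diag_mat a) (diag_mat b) Y \<in> loglik_values pos_diag Y"
      using a b by (intro loglik_valuesI) simp_all
    ultimately show ?thesis unfolding is_min_value_def loglik_values_def by blast
  qed
qed

subsection \<open>Singular matrices and matrices with a zero entry form null sets\<close>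

text \<open>By Tonelli and translation invariance, \<open>\<integral> |Z - t e| dt = \<integral> |{t. y + t e \<in> Z}| dy = 0\<close>, while the
  integrand on the left is constant.\<close>

lemma null_sets_if_countable_on_lines:
  fixes Z :: "'a::euclidean_space set"
  assumes Z: "Z \<in> sets borel" and line: "\<And>y. countable {t. y + t *\<^sub>R e \<in> Z}"
  shows "Z \<in> null_sets lborel"
proof -
  note Z[measurable]
  have shift: "(\<integral>\<^sup>+ y. indicator Z (y + t *\<^sub>R e) \<partial>lborel) = emeasure lborel Z" for t
  proof -
    have "emeasure lborel Z = (\<integral>\<^sup>+ y. indicator Z y \<partial>distr lborel borel ((+) (t *\<^sub>R e)))"
      by (simp add: lborel_distr_plus)
    also have "\<dots> = (\<integral>\<^sup>+ y. indicator Z (y + t *\<^sub>R e) \<partial>lborel)"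
      by (subst nn_integral_distr) (simp_all add: add.commute)
    finally show ?thesis by simp
  qed
  have null: "(\<integral>\<^sup>+ t. indicator Z (y + t *\<^sub>R e) \<partial>lborel) = 0" for y
  proof -
    have "{t. y + t *\<^sub>R e \<in> Z} \<in> null_sets lborel" by (rule countable_imp_null_set_lborel[OF line])
    then have "AE t in lborel. t \<notin> {t. y + t *\<^sub>R e \<in> Z}" by (rule AE_not_in)
    then have "AE t in lborel. (indicator Z (y + t *\<^sub>R e) :: ennreal) = 0" by (auto simp: indicator_def)
    then show ?thesis by (subst nn_integral_0_iff_AE) simp_all
  qed
  have "(\<integral>\<^sup>+ t. emeasure lborel Z \<partial>(lborel :: real measure)) = (\<integral>\<^sup>+ t. (\<integral>\<^sup>+ y. indicator Z (y + t *\<^sub>R e) \<partial>lborel) \<partial>lborel)"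
    by (simp add: shift)
  also have "\<dots> = (\<integral>\<^sup>+ y. (\<integral>\<^sup>+ t. indicator Z (y + t *\<^sub>R e) \<partial>lborel) \<partial>lborel)"
    by (rule lborel_pair.Fubini'[of "\<lambda>y t. indicator Z (y + t *\<^sub>R e)"]) measurable
  also have "\<dots> = 0" by (simp add: null)
  \<comment> \<open>The line has infinite measure, so a constant integrand with integral 0 must
    vanish.\<close>
  finally have "emeasure lborel Z * \<infinity> = 0" by simp
  then show ?thesis using Z by (auto simp: null_sets_def ennreal_mult_eq_top_iff)
qed

text \<open>The determinant is a polynomial in \<open>t\<close>. It is not the zero polynomial,
  because \<open>Y + t I\<close> is invertible once \<open>t\<close> exceeds the operator norm of
  \<open>Y\<close>.\<close>

lemma finite_det_zero_on_line:
  fixes Y :: "real^'n^'n"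
  shows "finite {t. det (Y + t *\<^sub>R mat 1) = 0}"
proof -
  \<comment> \<open>A determinant over the polynomial ring; evaluation commutes with the Leibniz
    sum.\<close>
  define p where "p = det (\<chi> i j. [:Y $ i $ j, if i = j then 1 else 0:])"
  have poly_p: "poly p t = det (Y + t *\<^sub>R mat 1)" for t
    unfolding p_def det_def
    by (simp add: poly_sum poly_prod mat_def)
  have "p \<noteq> 0"
  proof
    assume "p = 0"
    define t where "t = onorm ((*v) Y) + 1"
    have "x = 0" if "(Y + t *\<^sub>R mat 1) *v x = 0" for x
    proof (rule ccontr)
      assume "x \<noteq> 0"
      have "Y *v x = - (t *\<^sub>R x)"
        using that by (simp only: matrix_vector_mult_add_rdistrib scaleR_matrix_vector_assoc[symmetric] matrix_vector_mul_lid eq_neg_iff_add_eq_0)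
      then have "\<bar>t\<bar> * norm x = norm (Y *v x)" by simp
      also have "\<dots> \<le> onorm ((*v) Y) * norm x"
        by (rule onorm) (rule matrix_vector_mul_bounded_linear)
      finally have "\<bar>t\<bar> \<le> onorm ((*v) Y)"
        by (rule mult_right_le_imp_le) (simp add: \<open>x \<noteq> 0\<close>)
      then show False by (simp add: t_def)
    qed
    then have "invertible (Y + t *\<^sub>R mat 1)"
      unfolding invertible_left_inverse matrix_left_invertible_ker by blast
    then have "det (Y + t *\<^sub>R mat 1) \<noteq> 0" by (rule iffD1[OF invertible_det_nz])
    moreover have "det (Y + t *\<^sub>R mat 1) = 0" unfolding poly_p[symmetric] \<open>p = 0\<close> by (rule poly_0)
    ultimately show False by contradiction
  qed
  then show ?thesis using poly_roots_finite[of p] by (simp add: poly_p)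
qed

lemma continuous_on_det: "continuous_on UNIV (det :: real^'n^'n \<Rightarrow> real)"
  unfolding det_def[abs_def] by (intro continuous_intros)

lemma AE_lborel_det_nonzero: "AE Y in lborel. det (Y :: real^'n^'n) \<noteq> 0"
proof -
  have "closed {Y :: real^'n^'n. det Y = 0}"
    by (intro closed_Collect_eq continuous_on_det continuous_on_const)
  moreover have "countable {t. Y + t *\<^sub>R mat 1 \<in> {Y. det Y = 0}}" for Y :: "real^'n^'n"
    by (rule countable_finite) (simp add: finite_det_zero_on_line)
  ultimately have "{Y :: real^'n^'n. det Y = 0} \<in> null_sets lborel"
    by (intro null_sets_if_countable_on_lines borel_closed)
  from AE_not_in[OF this] show ?thesis by simp
qed

lemma AE_lborel_entry_nonzero: "AE Y in lborel. (Y :: real^'n^'m) $ i $ j \<noteq> 0"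
proof -
  have "{t. (y + t *\<^sub>R axis i (axis j 1)) $ i $ j = 0} = {- (y $ i $ j)}" for y :: "real^'n^'m"
    by auto
  moreover have "{Y :: real^'n^'m. Y $ i $ j = 0} \<in> sets borel"
    by (intro borel_closed closed_Collect_eq continuous_intros)
  ultimately have "{Y :: real^'n^'m. Y $ i $ j = 0} \<in> null_sets lborel"
    by (intro null_sets_if_countable_on_lines[where e="axis i (axis j 1)"]) simp_all
  from AE_not_in[OF this] show ?thesis by simp
qed

lemma AE_lborel_minimizers_exist: "AE Y in lborel. minimizers_exist (Y :: real^'m^'m)"
proof -
  have "AE Y in lborel. \<forall>i j. (Y :: real^'m^'m) $ i $ j \<noteq> 0"
    by (simp only: AE_all_countable AE_lborel_entry_nonzero simp_thms)
  then show ?thesis using AE_lborel_det_nonzero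
    by eventually_elim (auto simp: minimizers_exist_iff exists_min_value_sym_pos_def exists_min_value_pos_diag)
qed

subsection \<open>Measurability of the likelihood ratio statistic\<close>

definition sigma_compact :: "'a::topological_space set \<Rightarrow> bool" where
  "sigma_compact P \<longleftrightarrow> (\<exists>F. countable F \<and> (\<forall>K\<in>F. compact K) \<and> \<Union>F = P)"

lemma sigma_compact_Times:
  assumes "sigma_compact P" "sigma_compact Q"
  shows "sigma_compact (P \<times> Q)"
proof -
  obtain F where F: "countable F" "\<forall>K\<in>F. compact K" "\<Union>F = P" using assms(1) unfolding sigma_compact_def by blast
  obtain G where G: "countable G" "\<forall>K\<in>G. compact K" "\<Union>G = Q" using assms(2) unfolding sigma_compact_def by blast
  show ?thesis
    unfolding sigma_compact_def
  proof (intro exI[where x="(\<lambda>(K, L). K \<times> L) ` (F \<times> G)"] conjI)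
    show "countable ((\<lambda>(K, L). K \<times> L) ` (F \<times> G))" using F G by simp
    show "\<forall>K\<in>(\<lambda>(K, L). K \<times> L) ` (F \<times> G). compact K" using F G by (auto intro: compact_Times)
    show "\<Union>((\<lambda>(K, L). K \<times> L) ` (F \<times> G)) = P \<times> Q" using F G by auto
  qed
qed

text \<open>Although \<open>S\<close> may be uncountable, the strict sublevel sets of the infimum
  are unions of open sets. Extended reals cover empty and unbounded families.\<close>

lemma borel_measurable_INF_of_continuous:
  fixes L :: "'p \<Rightarrow> 'y::topological_space \<Rightarrow> real"
  assumes "\<And>p. p \<in> S \<Longrightarrow> continuous_on UNIV (L p)"
  shows "(\<lambda>y. INF p\<in>S. ereal (L p y)) \<in> borel_measurable borel"
proof (rule borel_measurableI_less)
  fix t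
  have "{y. (INF p\<in>S. ereal (L p y)) < t} = (\<Union>p\<in>S. {y. ereal (L p y) < t})"
    by (auto simp: INF_less_iff)
  moreover have "open (\<Union>p\<in>S. {y. ereal (L p y) < t})"
    using assms by (intro open_UN ballI open_Collect_less continuous_intros) auto
  ultimately show "{y \<in> space borel. (INF p\<in>S. ereal (L p y)) < t} \<in> sets borel" by simp
qed

text \<open>The minimum over \<open>P\<close> is attained iff for one of countably many compact pieces \<open>K\<close> of \<open>P\<close> the
  infimum over \<open>K\<close> equals the infimum over \<open>P\<close>.\<close>

lemma measurable_minimum:
  fixes L :: "'p::topological_space \<Rightarrow> 'y::topological_space \<Rightarrow> real"
  assumes P: "sigma_compact P"
    and cont: "\<And>y. continuous_on P (\<lambda>p. L p y)" "\<And>p. p \<in> P \<Longrightarrow> continuous_on UNIV (L p)"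
  shows "{y. \<exists>p\<in>P. \<forall>q\<in>P. L p y \<le> L q y} \<in> sets borel"
    and "\<exists>g\<in>borel_measurable borel. \<forall>y. \<forall>p\<in>P. (\<forall>q\<in>P. L p y \<le> L q y) \<longrightarrow> g y = L p y"
proof -
  define H where "H = (\<lambda>S y. INF p\<in>S. ereal (L p y))"
  obtain F where F: "countable F" "\<And>K. K \<in> F \<Longrightarrow> compact K" "\<Union>F = P"
    using P unfolding sigma_compact_def by blast
  have H_meas: "H S \<in> borel_measurable borel" if "S \<subseteq> P" for S
    unfolding H_def using that cont(2) by (intro borel_measurable_INF_of_continuous) auto
  have H_eq: "H S y = ereal (L p y)" if "p \<in> S" "\<forall>q\<in>S. L p y \<le> L q y" for S p y
    unfolding H_def using that by (intro antisym INF_lower INF_greatest) auto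
  \<comment> \<open>The empty piece is excluded: its infimum agrees with that over an empty
    \<open>P\<close>, yet nothing is attained there.\<close>
  have "(\<exists>p\<in>P. \<forall>q\<in>P. L p y \<le> L q y) \<longleftrightarrow> (\<exists>K\<in>F - {{}}. H K y = H P y)" for y
  proof
    assume "\<exists>p\<in>P. \<forall>q\<in>P. L p y \<le> L q y"
    then obtain p where p: "p \<in> P" "\<forall>q\<in>P. L p y \<le> L q y" by blast
    then obtain K where K: "K \<in> F" "p \<in> K" using F(3) by blast
    have "H K y = ereal (L p y)" using K p F(3) by (intro H_eq) blast+
    then show "\<exists>K\<in>F - {{}}. H K y = H P y" using K H_eq[OF p] by auto
  next
    assume "\<exists>K\<in>F - {{}}. H K y = H P y"
    then obtain K where K: "K \<in> F" "K \<noteq> {}" "H K y = H P y" by blast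
    have KP: "K \<subseteq> P" using K(1) F(3) by blast
    obtain p where p: "p \<in> K" "\<forall>q\<in>K. L p y \<le> L q y"
      using continuous_attains_inf[OF F(2)[OF K(1)] K(2) continuous_on_subset[OF cont(1) KP]] by blast
    have "L p y \<le> L q y" if "q \<in> P" for q
    proof -
      have "ereal (L p y) = H P y" using H_eq[OF p] K(3) by simp
      also have "\<dots> \<le> ereal (L q y)" unfolding H_def using that by (rule INF_lower)
      finally show ?thesis by simp
    qed
    then show "\<exists>p\<in>P. \<forall>q\<in>P. L p y \<le> L q y" using p(1) KP by blast
  qed
  then have "{y. \<exists>p\<in>P. \<forall>q\<in>P. L p y \<le> L q y} = (\<Union>K\<in>F - {{}}. {y\<in>space borel. H K y = H P y})" by auto
  also have "\<dots> \<in> sets borel"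
  proof (rule sets.countable_UN'')
    fix K assume "K \<in> F - {{}}"
    then have "K \<subseteq> P" using F(3) by blast
    then have [measurable]: "H K \<in> borel_measurable borel" "H P \<in> borel_measurable borel" by (simp_all add: H_meas)
    show "{y\<in>space borel. H K y = H P y} \<in> sets borel" by measurable
  qed (use F in simp)
  finally show "{y. \<exists>p\<in>P. \<forall>q\<in>P. L p y \<le> L q y} \<in> sets borel" .
  show "\<exists>g\<in>borel_measurable borel. \<forall>y. \<forall>p\<in>P. (\<forall>q\<in>P. L p y \<le> L q y) \<longrightarrow> g y = L p y"
  proof (rule bexI[rotated])
    show "(\<lambda>y. real_of_ereal (H P y)) \<in> borel_measurable borel" using H_meas[of P] by simp
  qed (use H_eq[of _ P] in auto)
qed

text \<open>Positivity is exhausted by the closed conditions D_ii \<ge> 1/(n+1), and the ball of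
  radius n makes each piece compact.\<close>

lemma sigma_compact_pos_diag: "sigma_compact (pos_diag :: (real^'m^'m) set)"
proof -
  define K :: "nat \<Rightarrow> (real^'m^'m) set" where
    "K n = cball 0 (real n) \<inter> {D. (\<forall>i. 1 / real (Suc n) \<le> D $ i $ i) \<and> (\<forall>i j. i \<noteq> j \<longrightarrow> D $ i $ j = 0)}" for n
  have "closed {D :: real^'m^'m. (\<forall>i. 1 / real (Suc n) \<le> D $ i $ i) \<and> (\<forall>i j. i \<noteq> j \<longrightarrow> D $ i $ j = 0)}" for n
    by (intro closed_Collect_conj closed_Collect_all closed_Collect_imp closed_Collect_le closed_Collect_eq
        continuous_intros) simp
  then have "compact (K n)" for n unfolding K_def by (intro compact_Int_closed) simp_all
  moreover have "\<Union>(range K) = pos_diag"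
  proof (intro equalityI subsetI)
    fix D assume "D \<in> \<Union>(range K)"
    then obtain n where n: "\<And>i. 1 / real (Suc n) \<le> D $ i $ i" "\<forall>i j. i \<noteq> j \<longrightarrow> D $ i $ j = 0"
      by (auto simp: K_def)
    have "0 < D $ i $ i" for i by (rule less_le_trans[OF _ n(1)]) simp
    then show "D \<in> pos_diag" using n(2) by (simp add: pos_diag_def)
  next
    fix D :: "real^'m^'m" assume D: "D \<in> pos_diag"
    define c where "c = Min (range (\<lambda>i. D $ i $ i))"
    have "c \<in> range (\<lambda>i. D $ i $ i)" unfolding c_def by (intro Min_in) auto
    then have "0 < c" using D by (auto simp: pos_diag_def)
    then obtain N where N: "1 / real (Suc N) < c" using nat_approx_posE by blast
    obtain N' where N': "norm D \<le> real N'" using real_arch_simple by blast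
    define n where "n = max N N'"
    have "1 / real (Suc n) \<le> 1 / real (Suc N)" by (simp add: n_def frac_le)
    moreover have "c \<le> D $ i $ i" for i unfolding c_def by (intro Min_le) auto
    ultimately have "1 / real (Suc n) \<le> D $ i $ i" for i using N by (smt (verit))
    moreover have "norm D \<le> real n" using N' by (simp add: n_def)
    ultimately have "D \<in> K n" using D by (simp add: K_def pos_diag_def)
    then show "D \<in> \<Union>(range K)" by blast
  qed
  ultimately show ?thesis unfolding sigma_compact_def by (intro exI[where x="range K"]) auto
qed

text \<open>Strict positivity is not a closed condition, but coercivity with constant 1/(n+1) is,
  and \<open>spd_coercive\<close> places every positive definite matrix in some piece.\<close>

lemma sigma_compact_sym_pos_def: "sigma_compact (sym_pos_def :: (real^'m^'m) set)"
proof -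
  define K :: "nat \<Rightarrow> (real^'m^'m) set" where
    "K n = cball 0 (real n) \<inter> {S. (\<forall>i j. S $ j $ i = S $ i $ j) \<and> (\<forall>x. 1 / real (Suc n) * (norm x)\<^sup>2 \<le> x \<bullet> (S *v x))}" for n
  have "closed {S :: real^'m^'m. (\<forall>i j. S $ j $ i = S $ i $ j) \<and> (\<forall>x. 1 / real (Suc n) * (norm x)\<^sup>2 \<le> x \<bullet> (S *v x))}" for n
    unfolding matrix_vector_mult_def inner_vec_def
    by (intro closed_Collect_conj closed_Collect_all closed_Collect_le closed_Collect_eq continuous_intros) simp_all
  then have "compact (K n)" for n unfolding K_def by (intro compact_Int_closed) simp_all
  moreover have "\<Union>(range K) = sym_pos_def"
  proof (intro equalityI subsetI)
    fix S assume "S \<in> \<Union>(range K)"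
    then obtain n where n: "\<forall>i j. S $ j $ i = S $ i $ j" "\<And>x. 1 / real (Suc n) * (norm x)\<^sup>2 \<le> x \<bullet> (S *v x)"
      by (auto simp: K_def)
    have "0 < x \<bullet> (S *v x)" if "x \<noteq> 0" for x
      by (rule less_le_trans[OF _ n(2)]) (simp add: that)
    then show "S \<in> sym_pos_def" using n(1) by (simp add: sym_pos_def_def transpose_def vec_eq_iff)
  next
    fix S :: "real^'m^'m" assume S: "S \<in> sym_pos_def"
    obtain c where c: "0 < c" "\<And>x. c * (norm x)\<^sup>2 \<le> x \<bullet> (S *v x)" using spd_coercive[OF S] by metis
    obtain N where N: "1 / real (Suc N) < c" using c(1) nat_approx_posE by blast
    obtain N' where N': "norm S \<le> real N'" using real_arch_simple by blast
    define n where "n = max N N'"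
    have "1 / real (Suc n) \<le> 1 / real (Suc N)" by (simp add: n_def frac_le)
    then have "1 / real (Suc n) * (norm x)\<^sup>2 \<le> c * (norm x)\<^sup>2" for x :: "real^'m"
      using N by (intro mult_right_mono) auto
    then have "1 / real (Suc n) * (norm x)\<^sup>2 \<le> x \<bullet> (S *v x)" for x using c(2) order_trans by blast
    moreover have "norm S \<le> real n" using N' by (simp add: n_def)
    moreover have "\<forall>i j. S $ j $ i = S $ i $ j" using S by (simp add: sym_pos_def_def transpose_def vec_eq_iff)
    ultimately have "S \<in> K n" by (simp add: K_def)
    then show "S \<in> \<Union>(range K)" by blast
  qed
  ultimately show ?thesis unfolding sigma_compact_def by (intro exI[where x="range K"]) auto
qed

lemma measurable_min_value:
  fixes P :: "(real^'m^'m) set"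
  assumes P: "sigma_compact P" "P \<subseteq> sym_pos_def"
  shows "{Y. \<exists>v. is_min_value P Y v} \<in> sets borel"
    and "\<exists>g\<in>borel_measurable borel. \<forall>Y v. is_min_value P Y v \<longrightarrow> g Y = v"
proof -
  define L where "L = (\<lambda>p. precision_loglik (fst p) (snd p :: real^'m^'m))"
  have eq: "is_min_value P Y v \<longleftrightarrow> (\<exists>p\<in>P \<times> P. v = L p Y \<and> (\<forall>q\<in>P \<times> P. L p Y \<le> L q Y))" for Y v
  proof -
    have "loglik_values P Y = (\<lambda>p. L p Y) ` (P \<times> P)" by (force simp: loglik_values_def L_def)
    then show ?thesis by (auto simp: is_min_value_def)
  qed
  \<comment> \<open>This keeps the logarithm continuous on all of
    \<open>P \<times> P\<close>.\<close>
  have "det (kronecker (snd p) (fst p)) > 0" if "p \<in> P \<times> P" for p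
    using that P(2) by (intro det_kronecker_pos) auto
  then have nz: "det (kronecker (snd p) (fst p)) \<noteq> 0" if "p \<in> P \<times> P" for p
    using that by (metis less_irrefl)
  have cont1: "continuous_on (P \<times> P) (\<lambda>p. L p Y)" for Y
    unfolding L_def precision_loglik_def trace_def matrix_matrix_mult_def
    by (intro continuous_intros) (use nz in \<open>auto simp: det_def intro!: continuous_intros\<close>)
  have cont2: "continuous_on UNIV (L p)" for p
    unfolding L_def precision_loglik_def trace_def matrix_matrix_mult_def transpose_def
    by (simp, intro continuous_intros)
  note min = measurable_minimum[of "P \<times> P" L, OF sigma_compact_Times[OF P(1) P(1)] cont1 cont2]
  have "{Y. \<exists>v. is_min_value P Y v} = {Y. \<exists>p\<in>P \<times> P. \<forall>q\<in>P \<times> P. L p Y \<le> L q Y}"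
    unfolding eq by blast
  then show "{Y. \<exists>v. is_min_value P Y v} \<in> sets borel" using min(1) by simp
  show "\<exists>g\<in>borel_measurable borel. \<forall>Y v. is_min_value P Y v \<longrightarrow> g Y = v"
    using min(2) unfolding eq by metis
qed

text \<open>On the Borel set where both minima exist \<open>lr_stat\<close> is a difference of
  measurable functions; off that set it is constant.\<close>

lemma lr_stat_borel_measurable [measurable]: "(lr_stat :: real^'m^'m \<Rightarrow> real) \<in> borel_measurable borel"
proof -
  note D = measurable_min_value[OF sigma_compact_pos_diag pos_diag_subset_sym_pos_def]
  note S = measurable_min_value[OF sigma_compact_sym_pos_def order_refl]
  obtain gD gS :: "real^'m^'m \<Rightarrow> real" where
    [measurable]: "gD \<in> borel_measurable borel" "gS \<in> borel_measurable borel" and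
    g: "\<And>Y v. is_min_value pos_diag Y v \<Longrightarrow> gD Y = v" "\<And>Y v. is_min_value sym_pos_def Y v \<Longrightarrow> gS Y = v"
    using D(2) S(2) by metis
  have "{Y :: real^'m^'m. minimizers_exist Y} = {Y. \<exists>v. is_min_value pos_diag Y v} \<inter> {Y. \<exists>v. is_min_value sym_pos_def Y v}"
    by (auto simp: minimizers_exist_iff)
  then have [measurable]: "{Y :: real^'m^'m. minimizers_exist Y} \<in> sets borel" using D(1) S(1) by (metis sets.Int)
  have "lr_stat Y = (if Y \<in> {Y. minimizers_exist Y} then gD Y - gS Y else (THE t. False))" for Y :: "real^'m^'m"
    using g lr_stat_if_min_values[of Y] lr_stat_if_no_minimizers[of Y] by (auto simp: minimizers_exist_iff)
  then have "lr_stat = (\<lambda>Y :: real^'m^'m. if Y \<in> {Y. minimizers_exist Y} then gD Y - gS Y else (THE t. False))"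
    by blast
  also have "\<dots> \<in> borel_measurable borel" by measurable
  finally show ?thesis .
qed

subsection \<open>Diagonal scaling of the standard matrix normal distribution\<close>

lemma mvn_density_borel_measurable [measurable]: "mvn_density \<mu> S \<in> borel_measurable borel"
proof -
  have "(\<lambda>x. exp (- ((x - \<mu>) \<bullet> (matrix_inv S *v (x - \<mu>))) / 2)) \<in> borel_measurable borel"
    unfolding matrix_vector_mult_def inner_vec_def
    by (intro borel_measurable_continuous_onI continuous_intros) simp
  then show ?thesis unfolding mvn_density_def[abs_def] by simp
qed

text \<open>The product of the s_i is the Jacobian of the scaling; it cancels the square root of the
  determinant in the normalizing constant.\<close>

lemma mvn_density_diag_mat_scale:
  fixes s x :: "real^'k"
  assumes s: "\<And>i. 0 < s $ i"
  shows "(\<Prod>i\<in>UNIV. s $ i) * mvn_density 0 (diag_mat (\<chi> i. (s $ i)\<^sup>2)) (diag_mat s *v x) = mvn_density 0 (mat 1) x"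
proof -
  have nz: "s $ i \<noteq> 0" for i using s[of i] by simp
  have "matrix_inv (diag_mat (\<chi> i. (s $ i)\<^sup>2)) = diag_mat (\<chi> i. 1 / (s $ i)\<^sup>2)"
    by (subst matrix_inv_diag_mat) (simp_all add: nz)
  then have "(diag_mat s *v x) \<bullet> (matrix_inv (diag_mat (\<chi> i. (s $ i)\<^sup>2)) *v (diag_mat s *v x)) = x \<bullet> x"
    by (simp add: diag_mat_mult_vec inner_vec_def power2_eq_square nz)
  moreover have "matrix_inv (mat 1 :: real^'k^'k) = mat 1" by (rule matrix_inv_unique) simp
  moreover have "sqrt ((2 * pi) ^ CARD('k) * det (diag_mat (\<chi> i. (s $ i)\<^sup>2))) = sqrt ((2 * pi) ^ CARD('k)) * (\<Prod>i\<in>UNIV. s $ i)"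
  proof -
    have "0 \<le> (\<Prod>i\<in>UNIV. s $ i)" using s by (intro prod_nonneg) (simp add: less_imp_le)
    then show ?thesis by (simp add: det_diag_mat real_sqrt_mult prod_power_distrib[symmetric])
  qed
  moreover have "(\<Prod>i\<in>UNIV. s $ i) \<noteq> 0" by (simp add: nz)
  ultimately show ?thesis by (simp add: mvn_density_def)
qed

lemma lborel_diag_mat_scale:
  fixes s :: "real^'k"
  assumes s: "\<And>i. 0 < s $ i"
  shows "lborel = density (distr lborel borel ((*v) (diag_mat s))) (\<lambda>_. ennreal (\<Prod>i\<in>UNIV. s $ i))"
proof -
  have Basis: "(Basis :: (real^'k) set) = range (\<lambda>i. axis i 1)" by (auto simp: Basis_vec_def)
  have inj: "inj (\<lambda>i::'k. axis i (1::real))" by (simp add: inj_on_def axis_eq_axis)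
  \<comment> \<open>Puts the diagonal map in the coordinate form used by the affine change of
    variables for \<open>lborel\<close>.\<close>
  have T: "0 + (\<Sum>j\<in>Basis. ((s \<bullet> j) * (x \<bullet> j)) *\<^sub>R j) = diag_mat s *v x" for x
  proof (rule euclidean_eqI)
    fix b :: "real^'k" assume b: "b \<in> Basis"
    then obtain i where "b = axis i 1" by (auto simp: Basis)
    have "(0 + (\<Sum>j\<in>Basis. ((s \<bullet> j) * (x \<bullet> j)) *\<^sub>R j)) \<bullet> b = (s \<bullet> b) * (x \<bullet> b)"
      using b by (simp only: add_0_left inner_sum_left_Basis)
    also have "\<dots> = (diag_mat s *v x) \<bullet> b"
      using \<open>b = axis i 1\<close> by (simp add: inner_axis diag_mat_mult_vec)
    finally show "(0 + (\<Sum>j\<in>Basis. ((s \<bullet> j) * (x \<bullet> j)) *\<^sub>R j)) \<bullet> b = (diag_mat s *v x) \<bullet> b" .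
  qed
  have "(\<Prod>j\<in>Basis. \<bar>s \<bullet> j\<bar>) = (\<Prod>i\<in>UNIV. s $ i)"
    unfolding Basis by (subst prod.reindex[OF inj]) (simp add: inner_axis s less_imp_le)
  moreover have "s \<bullet> j \<noteq> 0" if "j \<in> Basis" for j
    using that s less_imp_neq[OF s, symmetric] by (auto simp: Basis inner_axis)
  then have "lborel = density (distr lborel borel (\<lambda>x. 0 + (\<Sum>j\<in>Basis. ((s \<bullet> j) * (x \<bullet> j)) *\<^sub>R j)))
      (\<lambda>_. ennreal (\<Prod>j\<in>Basis. \<bar>s \<bullet> j\<bar>))"
    by (rule lborel_affine_euclidean)
  ultimately show ?thesis unfolding T by simp
qed

text \<open>A standard normal vector scaled coordinatewise by \<open>s\<close> is centered normal
  with variances s_i^2, by change of variables.\<close>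

lemma density_mvn_diag_mat:
  fixes s :: "real^'k"
  assumes s: "\<And>i. 0 < s $ i"
  shows "density lborel (\<lambda>x. ennreal (mvn_density 0 (diag_mat (\<chi> i. (s $ i)\<^sup>2)) x)) =
    distr (density lborel (\<lambda>x. ennreal (mvn_density 0 (mat 1) x))) borel ((*v) (diag_mat s))"
proof -
  let ?f = "\<lambda>x. ennreal (mvn_density 0 (diag_mat (\<chi> i. (s $ i)\<^sup>2)) x)"
  let ?k = "\<lambda>_ :: real^'k. ennreal (\<Prod>i\<in>UNIV. s $ i)"
  have T[measurable]: "(*v) (diag_mat s) \<in> borel_measurable borel"
    by (intro borel_measurable_continuous_onI continuous_intros)
  have "density lborel ?f = density (density (distr lborel borel ((*v) (diag_mat s))) ?k) ?f"
    by (subst lborel_diag_mat_scale[OF s]) (rule refl)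
  also have "\<dots> = density (distr lborel borel ((*v) (diag_mat s))) (\<lambda>x. ?k x * ?f x)"
    by (rule density_density_eq) simp_all
  also have "\<dots> = distr (density lborel (\<lambda>x. ?k (diag_mat s *v x) * ?f (diag_mat s *v x))) borel ((*v) (diag_mat s))"
    by (subst density_distr) simp_all
  also have "(\<lambda>x. ?k (diag_mat s *v x) * ?f (diag_mat s *v x)) = (\<lambda>x. ennreal (mvn_density 0 (mat 1) x))"
    using s by (simp add: mvn_density_diag_mat_scale[OF s, symmetric] ennreal_mult' prod_nonneg less_imp_le)
  finally show ?thesis .
qed

section \<open>Laws of statistics of a matrix normal variable\<close>

definition unvectorize :: "real^('n \<times> 'm) \<Rightarrow> real^'n^'m" where
  "unvectorize x = (\<chi> i j. x $ (j, i))"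

lemma unvectorize_vectorize [simp]: "unvectorize (vectorize Y) = Y"
  by (simp add: unvectorize_def vectorize_def vec_eq_iff)

lemma unvectorize_borel_measurable [measurable]: "unvectorize \<in> borel_measurable borel"
  unfolding unvectorize_def[abs_def] by (intro borel_measurable_continuous_onI continuous_intros)

lemma matrix_normal_measurable:
  fixes Y :: "'a \<Rightarrow> real^'n^'m"
  assumes "matrix_normal M Y A Sr Sc"
  shows "Y \<in> borel_measurable M"
proof -
  have "(\<lambda>\<omega>. vectorize (Y \<omega>)) \<in> measurable M lborel"
    using assms by (simp add: matrix_normal_def distributed_def)
  then have "(\<lambda>\<omega>. vectorize (Y \<omega>)) \<in> borel_measurable M" by (simp only: measurable_lborel1)
  from measurable_compose[OF this unvectorize_borel_measurable] show ?thesis by simp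
qed

text \<open>\<open>Y\<close> is recovered from its vectorization, so the density of the latter
  determines the law of every Borel statistic of \<open>Y\<close>.\<close>

lemma distr_matrix_normal:
  fixes Y :: "'a \<Rightarrow> real^'n^'m"
  assumes Y: "matrix_normal M Y A Sr Sc" and g[measurable]: "g \<in> borel_measurable borel"
  shows "distr M borel (\<lambda>\<omega>. g (Y \<omega>)) =
    distr (density lborel (\<lambda>x. ennreal (mvn_density (vectorize A) (kronecker Sc Sr) x))) borel (\<lambda>x. g (unvectorize x))"
proof -
  have vec_Y: "(\<lambda>\<omega>. vectorize (Y \<omega>)) \<in> measurable M lborel"
    using Y unfolding matrix_normal_def by (rule distributed_measurable)
  have "distr M borel (\<lambda>\<omega>. g (Y \<omega>)) = distr (distr M lborel (\<lambda>\<omega>. vectorize (Y \<omega>))) borel (\<lambda>x. g (unvectorize x))"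
    using vec_Y by (subst distr_distr) (simp_all add: comp_def)
  then show ?thesis using Y by (simp add: matrix_normal_def distributed_def)
qed

text \<open>Under a diagonal null hypothesis \<open>Y\<close> has the law of
  \<open>D1 ** Y0 ** D2\<close>, with \<open>D1\<close> and \<open>D2\<close> the square roots of
  \<open>Sr\<close> and \<open>Sc\<close>; invariance of the statistic then removes both
  factors.\<close>

lemma distr_lr_stat_matrix_normal:
  fixes Y :: "'a \<Rightarrow> real^'m^'m" and Y0 :: "'b \<Rightarrow> real^'m^'m"
  assumes S: "Sr \<in> pos_diag" "Sc \<in> pos_diag"
    and Y: "matrix_normal M Y 0 Sr Sc" and Y0: "matrix_normal M0 Y0 0 (mat 1) (mat 1)"
  shows "distr M borel (\<lambda>\<omega>. lr_stat (Y \<omega>)) = distr M0 borel (\<lambda>\<omega>. lr_stat (Y0 \<omega>))"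
proof -
  obtain r where r: "Sr = diag_mat r" "\<And>i. 0 < r $ i" using S(1) by (rule pos_diagE) blast
  obtain c where c: "Sc = diag_mat c" "\<And>i. 0 < c $ i" using S(2) by (rule pos_diagE) blast
  define D1 D2 where "D1 = diag_mat (\<chi> i. sqrt (r $ i))" and "D2 = diag_mat (\<chi> i. sqrt (c $ i))"
  have D: "D1 \<in> pos_diag" "D2 \<in> pos_diag" using r c by (simp_all add: D1_def D2_def)
  \<comment> \<open>The first index component is the column and the second the row, so column
    variances \<open>c\<close> pair with \<open>fst\<close>.\<close>
  define s :: "real^('m \<times> 'm)" where "s = (\<chi> p. sqrt (c $ fst p) * sqrt (r $ snd p))"
  have s: "0 < s $ p" for p using r c by (simp add: s_def)
  have K: "kronecker Sc Sr = diag_mat (\<chi> p. (s $ p)\<^sup>2)"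
    using r c by (simp add: kronecker_diag_mat s_def power_mult_distrib less_imp_le)
  have vec0: "vectorize (0 :: real^'m^'m) = 0" by (simp add: vectorize_def vec_eq_iff)
  have T: "unvectorize (diag_mat s *v x) = D1 ** unvectorize x ** D2" for x
    by (simp add: vec_eq_iff D1_def D2_def unvectorize_def diag_mat_mult_vec mul_diag_mat_nth diag_mat_mul_nth s_def)
  have [measurable]: "(*v) (diag_mat s) \<in> borel_measurable borel"
    by (intro borel_measurable_continuous_onI continuous_intros)
  let ?N = "density lborel (\<lambda>x :: real^('m \<times> 'm). ennreal (mvn_density 0 (mat 1) x))"
  have "distr M borel (\<lambda>\<omega>. lr_stat (Y \<omega>)) = distr (distr ?N borel ((*v) (diag_mat s))) borel (\<lambda>x. lr_stat (unvectorize x))"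
    unfolding distr_matrix_normal[OF Y lr_stat_borel_measurable] K vec0 density_mvn_diag_mat[OF s] ..
  also have "\<dots> = distr ?N borel (\<lambda>x. lr_stat (unvectorize x))"
    by (subst distr_distr) (simp_all add: comp_def T lr_stat_scale[OF D])
  also have "\<dots> = distr M0 borel (\<lambda>\<omega>. lr_stat (Y0 \<omega>))"
    unfolding distr_matrix_normal[OF Y0 lr_stat_borel_measurable] kronecker_mat_1 vec0 ..
  finally show ?thesis .
qed

theorem mainTheorem3:
  fixes M :: "'a measure" and M0 :: "'b measure"
  assumes "prob_space M" and "prob_space M0"
  shows "(\<forall>(Y :: 'a \<Rightarrow> real^'m^'m) D1 D2.
            D1 \<in> pos_diag \<longrightarrow> D2 \<in> pos_diag \<longrightarrow>
            Y \<in> borel_measurable M \<longrightarrow>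
            absolutely_continuous lborel (distr M lborel Y) \<longrightarrow>
            (AE \<omega> in M. minimizers_exist (Y \<omega>) \<and> minimizers_exist (D1 ** Y \<omega> ** D2) \<and>
               lr_stat (D1 ** Y \<omega> ** D2) = lr_stat (Y \<omega>)))
       \<and> (\<forall>(Y :: 'a \<Rightarrow> real^'m^'m) (Y0 :: 'b \<Rightarrow> real^'m^'m) Sr Sc.
            Sr \<in> pos_diag \<longrightarrow> Sc \<in> pos_diag \<longrightarrow>
            matrix_normal M Y 0 Sr Sc \<longrightarrow>
            matrix_normal M0 Y0 0 (mat 1) (mat 1) \<longrightarrow>
            (\<lambda>\<omega>. lr_stat (Y \<omega>)) \<in> borel_measurable M \<and>
            (\<lambda>\<omega>. lr_stat (Y0 \<omega>)) \<in> borel_measurable M0 \<and>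
            distr M borel (\<lambda>\<omega>. lr_stat (Y \<omega>)) = distr M0 borel (\<lambda>\<omega>. lr_stat (Y0 \<omega>)))"
proof (intro conjI allI impI)
  fix Y :: "'a \<Rightarrow> real^'m^'m" and D1 D2 :: "real^'m^'m"
  assume D: "D1 \<in> pos_diag" "D2 \<in> pos_diag" and Y: "Y \<in> borel_measurable M"
    and ac: "absolutely_continuous lborel (distr M lborel Y)"
  \<comment> \<open>Absolute continuity carries Lebesgue-null exceptional sets over to the law of
    \<open>Y\<close>.\<close>
  have "AE y in distr M lborel Y. minimizers_exist y"
    by (rule absolutely_continuous_AE[OF _ ac AE_lborel_minimizers_exist]) simp
  then have "AE \<omega> in M. minimizers_exist (Y \<omega>)"
    by (rule AE_distrD[rotated]) (simp add: Y)
  then show "AE \<omega> in M. minimizers_exist (Y \<omega>) \<and> minimizers_exist (D1 ** Y \<omega> ** D2) \<and>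
      lr_stat (D1 ** Y \<omega> ** D2) = lr_stat (Y \<omega>)"
    by (simp add: minimizers_exist_scale[OF D] lr_stat_scale[OF D])
next
  fix Y :: "'a \<Rightarrow> real^'m^'m" and Y0 :: "'b \<Rightarrow> real^'m^'m" and Sr Sc :: "real^'m^'m"
  assume S: "Sr \<in> pos_diag" "Sc \<in> pos_diag" and Y: "matrix_normal M Y 0 Sr Sc"
    and Y0: "matrix_normal M0 Y0 0 (mat 1) (mat 1)"
  show "(\<lambda>\<omega>. lr_stat (Y \<omega>)) \<in> borel_measurable M"
    by (rule measurable_compose[OF matrix_normal_measurable[OF Y] lr_stat_borel_measurable])
  show "(\<lambda>\<omega>. lr_stat (Y0 \<omega>)) \<in> borel_measurable M0"
    by (rule measurable_compose[OF matrix_normal_measurable[OF Y0] lr_stat_borel_measurable])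
  show "distr M borel (\<lambda>\<omega>. lr_stat (Y \<omega>)) = distr M0 borel (\<lambda>\<omega>. lr_stat (Y0 \<omega>))"
    by (rule distr_lr_stat_matrix_normal[OF S Y Y0])
qed

end
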